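(* There exist a constant $c>0$ and $h_0\in\mathbb N$ such that for every $h\ge h_0$, the random tournament $H\sim\mathcal T(h,1/2)$ is not locally forcing with probability at least $c$.
   Context: A tournament $T=(V,E)$ is a finite vertex set $V=V(T)$ with edge set $E=E(T)\subset V\times V$ such that $(u,u)\notin E$ for all $u$, and exactly one of $(u,v),(v,u)$ lies in $E$ for all distinct $u,v\in V$. An $n$-vertex tournament is one with $|V(T)|=n$. $\mathcal T(h,1/2)$ is the random tournament on vertex set $\{1,\dots,h\}$ in which each pair $\{i,j\}$ is oriented in one of the two directions with probability $1/2$ each, independently over all pairs. An ordering of $T$ is a bijection $\sigma:V(T)\to\{1,\dots,n\}$; $F_{\sigma,T}$ is the set of edges $(u,v)\in E(T)$ with $\sigma(u)<\sigma(v)$. For tournaments $H,T$, a labelled embedding of $H$ into $T$ is a map $\phi:V(H)\to V(T)$ such that $(u,v)\in E(H)$ if and only if $(\phi(u),\phi(v))\in E(T)$. For $U\subset V(T)$, $N^*_T(H;U)$ is the number of labelled embeddings of $H$ into the subtournament $T[U]$ induced by $U$. An $h$-vertex tournament $H$ is locally forcing if for every $\varepsilon>0$ there are $\delta>0$ and $n_0\in\mathbb N$ such that every $n$-vertex tournament $T$ with $n\ge n_0$ and $\left|N^*_T(H;U)-2^{-\binom h2}|U|^h\right|\le\delta n^h$ for every $U\subset V(T)$ satisfies $\left||F_{\sigma,T}|-\frac12\binom n2\right|\le\varepsilon n^2$ for every ordering $\sigma$ of $T$. *)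

theory Defs
  imports "HOL-Probability.Probability" "Graph_Theory.Pair_Digraph"
begin

locale tournament = pair_digraph T for T :: "'a pair_pre_digraph" +
  assumes exactly_one_arc:
    "\<And>u v. \<lbrakk>u \<in> pverts T; v \<in> pverts T; u \<noteq> v\<rbrakk> \<Longrightarrow> (u, v) \<in> parcs T \<longleftrightarrow> (v, u) \<notin> parcs T"

definition ordering :: "'a pair_pre_digraph \<Rightarrow> ('a \<Rightarrow> nat) \<Rightarrow> bool" where
  "ordering T \<sigma> \<longleftrightarrow> bij_betw \<sigma> (pverts T) {1..card (pverts T)}"

definition forward_arcs :: "('a \<Rightarrow> nat) \<Rightarrow> 'a pair_pre_digraph \<Rightarrow> 'a rel" where
  "forward_arcs \<sigma> T = {(u, v) \<in> parcs T. \<sigma> u < \<sigma> v}"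

definition induced :: "'a pair_pre_digraph \<Rightarrow> 'a set \<Rightarrow> 'a pair_pre_digraph" where
  "induced T U = \<lparr>pverts = U, parcs = parcs T \<inter> U \<times> U\<rparr>"

text \<open>Embeddings are extensional functions, so that distinct functions are distinct maps on
  the vertex set and the set can be counted. Injectivity is not required explicitly: between
  tournaments it follows from the absence of loops.\<close>

definition labelled_embeddings :: "'a pair_pre_digraph \<Rightarrow> 'b pair_pre_digraph \<Rightarrow> ('a \<Rightarrow> 'b) set" where
  "labelled_embeddings H T =
    {\<phi> \<in> pverts H \<rightarrow>\<^sub>E pverts T.
      \<forall>u\<in>pverts H. \<forall>v\<in>pverts H. (u, v) \<in> parcs H \<longleftrightarrow> (\<phi> u, \<phi> v) \<in> parcs T}"

definition num_embeddings :: "'b pair_pre_digraph \<Rightarrow> 'a pair_pre_digraph \<Rightarrow> 'b set \<Rightarrow> nat" where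
  "num_embeddings T H U = card (labelled_embeddings H (induced T U))"

text \<open>The host tournaments have natural numbers as vertices; the vertex set is an arbitrary
  finite set of them, so every finite tournament occurs up to isomorphism.\<close>

definition locally_forcing :: "'a pair_pre_digraph \<Rightarrow> bool" where
  "locally_forcing H \<longleftrightarrow>
    (let h = card (pverts H) in
     \<forall>\<epsilon>::real. \<epsilon> > 0 \<longrightarrow>
       (\<exists>\<delta>::real. \<delta> > 0 \<and> (\<exists>n\<^sub>0::nat.
         \<forall>(T :: nat pair_pre_digraph) n.
           tournament T \<and> card (pverts T) = n \<and> n \<ge> n\<^sub>0 \<and>
           (\<forall>U \<subseteq> pverts T.
              \<bar>real (num_embeddings T H U) - real (card U) ^ h / 2 ^ (h choose 2)\<bar>
                \<le> \<delta> * real n ^ h) \<longrightarrow>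
           (\<forall>\<sigma>. ordering T \<sigma> \<longrightarrow>
              \<bar>real (card (forward_arcs \<sigma> T)) - 1 / 2 * real (n choose 2)\<bar>
                \<le> \<epsilon> * real n ^ 2))))"

text \<open>For a pair \<open>i < j\<close>, the coin \<open>\<omega> (i, j)\<close> decides between the arcs \<open>(i, j)\<close> and \<open>(j, i)\<close>.\<close>

definition vertex_pairs :: "nat \<Rightarrow> (nat \<times> nat) set" where
  "vertex_pairs h = {(i, j). 1 \<le> i \<and> i < j \<and> j \<le> h}"

definition oriented :: "nat \<Rightarrow> (nat \<times> nat \<Rightarrow> bool) \<Rightarrow> nat pair_pre_digraph" where
  "oriented h \<omega> =
    \<lparr>pverts = {1..h},
     parcs = {(i, j) | i j. (i, j) \<in> vertex_pairs h \<and> \<omega> (i, j)}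
           \<union> {(j, i) | i j. (i, j) \<in> vertex_pairs h \<and> \<not> \<omega> (i, j)}\<rparr>"

definition random_tournament :: "nat \<Rightarrow> nat pair_pre_digraph pmf" where
  "random_tournament h =
    map_pmf (oriented h) (Pi_pmf (vertex_pairs h) False (\<lambda>_. bernoulli_pmf (1 / 2)))"

lemma tournament_oriented: "tournament (oriented h \<omega>)"
proof
  show "finite (parcs (oriented h \<omega>))"
    by (rule finite_subset[of _ "{1..h} \<times> {1..h}"]) (auto simp: oriented_def vertex_pairs_def)
next
  fix u v assume "u \<in> pverts (oriented h \<omega>)" "v \<in> pverts (oriented h \<omega>)" "u \<noteq> v"
  then show "(u, v) \<in> parcs (oriented h \<omega>) \<longleftrightarrow> (v, u) \<notin> parcs (oriented h \<omega>)"
    by (cases u v rule: linorder_cases) (auto simp: oriented_def vertex_pairs_def)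
qed (auto simp: oriented_def vertex_pairs_def)

end

theory Submission
  imports Defs "HOL-Real_Asymp.Real_Asymp"
begin

text \<open>
  Orient each pair \<open>i < j\<close> of \<open>{1..n}\<close> forwards with probability \<open>(1 + t) / 2\<close>, independently,
  where \<open>t > 0\<close> does not depend on \<open>n\<close>. The resulting host is biased: the natural ordering has a
  fraction \<open>(1 + t) / 2\<close> of forward arcs. It is nevertheless possible that every vertex set spans
  the right number of copies of \<open>H\<close>. Indeed the host is close in cut norm to its kernel of
  expectations, so by a counting lemma the number of copies in \<open>U\<close> is governed by that kernel; and
  since the kernel only depends on the order of its arguments, all \<open>h\<close>-subsets of \<open>U\<close> contribute
  the same amount. The counts are therefore correct for all \<open>U\<close> at once as soon as the single equation
  \<open>P(t) = h!\<close> holds, where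
  \<open>P(t) = (\<Sum>\<sigma>. \<Prod>(u, v)\<in>H. 1 + t * sgn (\<sigma> v - \<sigma> u))\<close>, summed over the permutations \<open>\<sigma>\<close>
  of the vertices of \<open>H\<close> (\<open>order_poly\<close>).

  Now \<open>P(0) = h!\<close>, \<open>P'(0) = 0\<close>, and computing correlations of order relations in a random
  permutation shows that \<open>P''(0)\<close> is a positive multiple of
  \<open>X = (\<Sum>v. (outdeg v - indeg v)\<^sup>2) - h (h - 1)\<close> (\<open>score_excess\<close>). At \<open>t = 1\<close> only the permutations
  putting all arcs forwards survive, so \<open>P(1) = 0\<close> unless \<open>H\<close> is transitive. Hence for
  non-transitive \<open>H\<close> with \<open>X > 0\<close> the intermediate value theorem provides a suitable \<open>t\<close>
  (\<open>exists_balanced_bias\<close>), and \<open>H\<close> is not locally forcing (\<open>not_locally_forcing\<close>).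

  For random \<open>H\<close> the quantity \<open>X\<close> is a homogeneous polynomial of degree two in the independent signs
  of the pairs. It has mean zero, and by the Bonami lemma its fourth moment is at most \<open>81\<close> times the
  square of its second moment, so it cannot be positive too rarely (\<open>positive_part_large\<close>).
  Transitive tournaments are a negligible fraction \<open>h! / 2^(h choose 2)\<close> of all tournaments.
\<close>

section \<open>Low-degree polynomials on the discrete cube\<close>

text \<open>
  A subset \<open>Y\<close> of the coordinates stands for the point of the cube \<open>{-1, 1}^I\<close> that is \<open>1\<close> exactly
  on \<open>Y\<close>. The functions \<open>walsh S\<close> are the characters of the cube.
\<close>
definition coin :: "'a \<Rightarrow> 'a set \<Rightarrow> real" where
  "coin e Y = (if e \<in> Y then 1 else -1)"

definition walsh :: "'a set \<Rightarrow> 'a set \<Rightarrow> real" where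
  "walsh S Y = (\<Prod>e\<in>S. coin e Y)"

definition cube_avg :: "'a set \<Rightarrow> ('a set \<Rightarrow> real) \<Rightarrow> real" where
  "cube_avg I F = (\<Sum>Y\<in>Pow I. F Y) / 2 ^ card I"

lemma sum_Pow_insert:
  fixes F :: "'a set \<Rightarrow> real"
  assumes "finite I" "i \<notin> I"
  shows "(\<Sum>Y\<in>Pow (insert i I). F Y) = (\<Sum>Y\<in>Pow I. F Y + F (insert i Y))"
proof -
  have inj: "inj_on (insert i) (Pow I)"
    using assms(2) by (auto simp: inj_on_def)
  have "(\<Sum>Y\<in>Pow (insert i I). F Y) = (\<Sum>Y\<in>Pow I. F Y) + (\<Sum>Y\<in>insert i ` Pow I. F Y)"
    unfolding Pow_insert using assms by (subst sum.union_disjoint) auto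
  also have "(\<Sum>Y\<in>insert i ` Pow I. F Y) = (\<Sum>Y\<in>Pow I. F (insert i Y))"
    using inj by (simp add: sum.reindex)
  finally show ?thesis by (simp add: sum.distrib)
qed

lemma cube_avg_insert:
  assumes "finite I" "i \<notin> I"
  shows "cube_avg (insert i I) F = cube_avg I (\<lambda>Y. (F Y + F (insert i Y)) / 2)"
  using assms by (simp add: cube_avg_def sum_Pow_insert sum_divide_distrib[symmetric])

lemma cube_avg_cong: "(\<And>Y. Y \<subseteq> I \<Longrightarrow> F Y = G Y) \<Longrightarrow> cube_avg I F = cube_avg I G"
  unfolding cube_avg_def by (auto intro!: arg_cong2[where f="(/)"] sum.cong)

lemma cube_avg_mono: "(\<And>Y. Y \<subseteq> I \<Longrightarrow> F Y \<le> G Y) \<Longrightarrow> cube_avg I F \<le> cube_avg I G"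
  unfolding cube_avg_def by (auto intro!: divide_right_mono sum_mono)

lemma cube_avg_add: "cube_avg I (\<lambda>Y. F Y + G Y) = cube_avg I F + cube_avg I G"
  by (simp add: cube_avg_def sum.distrib add_divide_distrib)

lemma cube_avg_cmult: "cube_avg I (\<lambda>Y. c * F Y) = c * cube_avg I F"
  by (simp add: cube_avg_def sum_distrib_left)

lemma cube_avg_nonneg: "(\<And>Y. Y \<subseteq> I \<Longrightarrow> 0 \<le> F Y) \<Longrightarrow> 0 \<le> cube_avg I F"
  unfolding cube_avg_def by (auto intro!: divide_nonneg_nonneg sum_nonneg)

lemma cube_avg_Cauchy_Schwarz:
  "(cube_avg I (\<lambda>Y. F Y * G Y))\<^sup>2 \<le> cube_avg I (\<lambda>Y. (F Y)\<^sup>2) * cube_avg I (\<lambda>Y. (G Y)\<^sup>2)"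
  using divide_right_mono[OF Cauchy_Schwarz_ineq_sum[of F G "Pow I"], of "2 ^ card I * 2 ^ card I"]
  by (simp add: cube_avg_def power_divide power2_eq_square)

lemma walsh_insert_coordinate:
  assumes "finite I" "i \<notin> I" "S \<subseteq> I" "Y \<subseteq> I"
  shows "walsh S (insert i Y) = walsh S Y"
    and "walsh (insert i S) Y = - walsh S Y"
    and "walsh (insert i S) (insert i Y) = walsh S Y"
proof -
  have fin: "finite S" and nin: "i \<notin> S" "i \<notin> Y"
    using assms finite_subset by auto
  show 1: "walsh S (insert i Y) = walsh S Y"
    unfolding walsh_def coin_def using nin by (intro prod.cong) auto
  show "walsh (insert i S) Y = - walsh S Y"
    unfolding walsh_def using fin nin by (simp add: coin_def)
  show "walsh (insert i S) (insert i Y) = walsh S Y"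
    using 1 fin nin unfolding walsh_def by (simp add: coin_def)
qed

text \<open>Adding a coordinate cancels all characters that contain it, so only the constant survives.\<close>
lemma cube_avg_walsh_sum:
  assumes "finite I"
  shows "cube_avg I (\<lambda>Y. \<Sum>S\<in>Pow I. a S * walsh S Y) = a {}"
  using assms
proof (induction I arbitrary: a rule: finite_induct)
  case empty
  show ?case by (simp add: cube_avg_def walsh_def)
next
  case (insert i I)
  have "cube_avg (insert i I) (\<lambda>Y. \<Sum>S\<in>Pow (insert i I). a S * walsh S Y)
      = cube_avg I (\<lambda>Y. \<Sum>S\<in>Pow I. a S * walsh S Y)"
    unfolding cube_avg_insert[OF insert.hyps]
  proof (rule cube_avg_cong)
    fix Y assume "Y \<subseteq> I"
    then show "((\<Sum>S\<in>Pow (insert i I). a S * walsh S Y)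
        + (\<Sum>S\<in>Pow (insert i I). a S * walsh S (insert i Y))) / 2
      = (\<Sum>S\<in>Pow I. a S * walsh S Y)"
      unfolding sum_Pow_insert[OF insert.hyps] sum.distrib[symmetric] sum_divide_distrib
      by (intro sum.cong) (simp_all add: walsh_insert_coordinate[OF insert.hyps])
  qed
  then show ?case using insert.IH by simp
qed

text \<open>
  The Bonami lemma for polynomials of degree at most \<open>d\<close>. Singling out a coordinate \<open>i\<close> writes
  \<open>f = g + x\<^sub>i k\<close> with \<open>k\<close> of smaller degree. Averaging over \<open>x\<^sub>i\<close> kills the odd powers of \<open>x\<^sub>i\<close>, leaving
  \<open>E f\<^sup>4 = E g\<^sup>4 + 6 E g\<^sup>2 k\<^sup>2 + E k\<^sup>4\<close> and \<open>E f\<^sup>2 = E g\<^sup>2 + E k\<^sup>2\<close>; the Cauchy-Schwarz inequality bounds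
  the mixed term, and \<open>6 * sqrt (9^d * 9^(d-1)) = 2 * 9^d\<close> is exactly what the square allows.
\<close>
lemma Bonami_fourth_moment:
  assumes "finite I" and "\<And>S. S \<subseteq> I \<Longrightarrow> card S > d \<Longrightarrow> a S = 0"
  shows "cube_avg I (\<lambda>Y. (\<Sum>S\<in>Pow I. a S * walsh S Y) ^ 4)
    \<le> 9 ^ d * (cube_avg I (\<lambda>Y. (\<Sum>S\<in>Pow I. a S * walsh S Y)\<^sup>2))\<^sup>2"
  using assms
proof (induction I arbitrary: a d rule: finite_induct)
  case empty
  have "a {} ^ 4 \<le> 9 ^ d * a {} ^ 4"
    using mult_right_mono[of 1 "9 ^ d" "a {} ^ 4"] by simp
  then show ?case by (simp add: cube_avg_def walsh_def)
next
  case (insert i I)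
  define f where "f Y = (\<Sum>S\<in>Pow (insert i I). a S * walsh S Y)" for Y
  define g where "g Y = (\<Sum>S\<in>Pow I. a S * walsh S Y)" for Y
  define k where "k Y = (\<Sum>S\<in>Pow I. a (insert i S) * walsh S Y)" for Y
  have f: "f Y = g Y - k Y" "f (insert i Y) = g Y + k Y" if "Y \<subseteq> I" for Y
    unfolding f_def g_def k_def sum_Pow_insert[OF insert.hyps]
    using walsh_insert_coordinate[OF insert.hyps _ that]
    by (simp_all add: sum.distrib[symmetric] sum_subtractf[symmetric])
  have f2: "cube_avg (insert i I) (\<lambda>Y. (f Y)\<^sup>2)
      = cube_avg I (\<lambda>Y. (g Y)\<^sup>2) + cube_avg I (\<lambda>Y. (k Y)\<^sup>2)"
    unfolding cube_avg_insert[OF insert.hyps] cube_avg_add[symmetric]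
    by (rule cube_avg_cong) (simp add: f power2_eq_square field_simps)
  have f4: "cube_avg (insert i I) (\<lambda>Y. f Y ^ 4) = cube_avg I (\<lambda>Y. g Y ^ 4)
      + 6 * cube_avg I (\<lambda>Y. (g Y)\<^sup>2 * (k Y)\<^sup>2) + cube_avg I (\<lambda>Y. k Y ^ 4)"
    unfolding cube_avg_insert[OF insert.hyps] cube_avg_add[symmetric] cube_avg_cmult[symmetric]
    by (rule cube_avg_cong) (simp add: f power2_eq_square power4_eq_xxxx field_simps)
  define G K where "G = cube_avg I (\<lambda>Y. (g Y)\<^sup>2)" and "K = cube_avg I (\<lambda>Y. (k Y)\<^sup>2)"
  have GK: "G \<ge> 0" "K \<ge> 0" unfolding G_def K_def by (auto intro: cube_avg_nonneg)
  have g4: "cube_avg I (\<lambda>Y. g Y ^ 4) \<le> 9 ^ d * G\<^sup>2"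
    unfolding g_def G_def by (rule insert.IH) (use insert.prems in auto)
  show ?case
  proof (cases d)
    case 0
    have "a (insert i S) = 0" if "S \<subseteq> I" for S
      using insert.prems[of "insert i S"] that insert.hyps finite_subset[OF that]
      by (auto simp: 0 card_gt_0_iff)
    then have k0: "k Y = 0" for Y unfolding k_def by (auto intro!: sum.neutral)
    then show ?thesis
      using f2 f4 g4 unfolding f_def[symmetric] G_def by (simp add: k0 cube_avg_def)
  next
    case (Suc d')
    have k4: "cube_avg I (\<lambda>Y. k Y ^ 4) \<le> 9 ^ d' * K\<^sup>2"
      unfolding k_def K_def
    proof (rule insert.IH)
      fix S assume S: "S \<subseteq> I" "card S > d'"
      have "finite S" "i \<notin> S" using S(1) insert.hyps finite_subset by auto
      then show "a (insert i S) = 0"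
        using insert.prems[of "insert i S"] S Suc by auto
    qed
    \<comment> \<open>The mixed term carries the geometric mean of the two constants.\<close>
    have CS: "(cube_avg I (\<lambda>Y. (g Y)\<^sup>2 * (k Y)\<^sup>2))\<^sup>2
        \<le> cube_avg I (\<lambda>Y. g Y ^ 4) * cube_avg I (\<lambda>Y. k Y ^ 4)"
      using cube_avg_Cauchy_Schwarz[of I "\<lambda>Y. (g Y)\<^sup>2" "\<lambda>Y. (k Y)\<^sup>2"] by simp
    have bd: "cube_avg I (\<lambda>Y. g Y ^ 4) * cube_avg I (\<lambda>Y. k Y ^ 4)
        \<le> (9 ^ d * G\<^sup>2) * (9 ^ d' * K\<^sup>2)"
      by (intro mult_mono g4 k4) (auto intro: cube_avg_nonneg)
    have "(9 ^ d * G\<^sup>2) * (9 ^ d' * K\<^sup>2) = (3 * 9 ^ d' * G * K)\<^sup>2"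
      by (simp add: Suc power_mult_distrib power2_eq_square)
    with CS bd have "(cube_avg I (\<lambda>Y. (g Y)\<^sup>2 * (k Y)\<^sup>2))\<^sup>2 \<le> (3 * 9 ^ d' * G * K)\<^sup>2"
      by linarith
    then have gk: "cube_avg I (\<lambda>Y. (g Y)\<^sup>2 * (k Y)\<^sup>2) \<le> 3 * 9 ^ d' * G * K"
      by (rule power2_le_imp_le) (use GK in simp)
    have "cube_avg (insert i I) (\<lambda>Y. f Y ^ 4)
        \<le> 9 ^ d * G\<^sup>2 + 6 * (3 * 9 ^ d' * G * K) + 9 ^ d' * K\<^sup>2"
      unfolding f4 using g4 gk k4 by simp
    also have "\<dots> \<le> 9 ^ d * (G + K)\<^sup>2"
    proof -
      have "9 ^ d * (G + K)\<^sup>2 - (9 ^ d * G\<^sup>2 + 6 * (3 * 9 ^ d' * G * K) + 9 ^ d' * K\<^sup>2)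
          = 8 * (9 ^ d' * K\<^sup>2)"
        unfolding Suc power_Suc power2_eq_square by (simp add: distrib_left distrib_right)
      moreover have "0 \<le> 9 ^ d' * K\<^sup>2" by simp
      ultimately show ?thesis by linarith
    qed
    finally show ?thesis
      unfolding f_def[symmetric] G_def K_def f2 .
  qed
qed

text \<open>
  A centred function with controlled fourth moment has a first absolute moment comparable to its
  standard deviation. Half of this first moment comes from the positive part, which by the
  Cauchy-Schwarz inequality then cannot live on a small set.
\<close>
lemma positive_part_large:
  assumes fin: "finite I" and mean: "cube_avg I X = 0"
    and fourth: "cube_avg I (\<lambda>Y. X Y ^ 4) \<le> 81 * (cube_avg I (\<lambda>Y. (X Y)\<^sup>2))\<^sup>2"
    and nz: "Y\<^sub>0 \<subseteq> I" "X Y\<^sub>0 \<noteq> 0"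
  shows "real (card {Y \<in> Pow I. X Y > 0}) \<ge> 2 ^ card I / 2592"
proof -
  define s where "s = cube_avg I (\<lambda>Y. (X Y)\<^sup>2)"
  have "(\<Sum>Y\<in>Pow I. (X Y)\<^sup>2) > 0"
    using nz fin by (intro sum_pos2[of _ Y\<^sub>0]) auto
  then have s: "s > 0" by (simp add: s_def cube_avg_def)
  \<comment> \<open>Beyond the threshold \<open>l\<close> the fourth moment leaves at most half of the second moment.\<close>
  define l where "l = sqrt (162 * s)"
  have l: "l > 0" "l\<^sup>2 = 162 * s" using s by (simp_all add: l_def)
  have "(X Y)\<^sup>2 \<le> l * \<bar>X Y\<bar> + X Y ^ 4 * (1 / l\<^sup>2)" for Y
  proof (cases "\<bar>X Y\<bar> \<le> l")
    case True
    then have "\<bar>X Y\<bar> * \<bar>X Y\<bar> \<le> l * \<bar>X Y\<bar>" by (intro mult_right_mono) auto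
    moreover have "0 \<le> X Y ^ 4 * (1 / l\<^sup>2)" by simp
    ultimately show ?thesis unfolding power2_eq_square abs_mult_self_eq by linarith
  next
    case False
    then have "l\<^sup>2 \<le> (X Y)\<^sup>2" using l(1) by (simp add: abs_le_square_iff[symmetric])
    then have "(X Y)\<^sup>2 * l\<^sup>2 \<le> (X Y)\<^sup>2 * (X Y)\<^sup>2" by (intro mult_left_mono) auto
    then have "(X Y)\<^sup>2 \<le> X Y ^ 4 * (1 / l\<^sup>2)"
      using l(1) by (simp add: field_simps power4_eq_xxxx power2_eq_square)
    moreover have "0 \<le> l * \<bar>X Y\<bar>" using l(1) by simp
    ultimately show ?thesis by linarith
  qed
  then have "s \<le> cube_avg I (\<lambda>Y. l * \<bar>X Y\<bar> + (1 / l\<^sup>2) * X Y ^ 4)"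
    unfolding s_def by (intro cube_avg_mono) (simp add: mult.commute)
  also have "\<dots> = l * cube_avg I (\<lambda>Y. \<bar>X Y\<bar>) + (1 / l\<^sup>2) * cube_avg I (\<lambda>Y. X Y ^ 4)"
    by (simp only: cube_avg_add cube_avg_cmult)
  also have "\<dots> \<le> l * cube_avg I (\<lambda>Y. \<bar>X Y\<bar>) + (1 / l\<^sup>2) * (81 * s\<^sup>2)"
    using fourth unfolding s_def by (intro add_left_mono mult_left_mono) auto
  also have "(1 / l\<^sup>2) * (81 * s\<^sup>2) = s / 2"
    using s unfolding l(2) by (simp add: power2_eq_square)
  finally have abs_large: "s \<le> 2 * l * cube_avg I (\<lambda>Y. \<bar>X Y\<bar>)" by simp
  define q where "q = cube_avg I (\<lambda>Y. of_bool (X Y > 0))"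
  have "cube_avg I (\<lambda>Y. \<bar>X Y\<bar>) = cube_avg I (\<lambda>Y. \<bar>X Y\<bar> + X Y)"
    by (simp add: cube_avg_add mean)
  also have "\<dots> = 2 * cube_avg I (\<lambda>Y. X Y * of_bool (X Y > 0))"
    unfolding cube_avg_cmult[symmetric] by (rule cube_avg_cong) auto
  finally have abs_eq: "cube_avg I (\<lambda>Y. \<bar>X Y\<bar>) = 2 * cube_avg I (\<lambda>Y. X Y * of_bool (X Y > 0))" .
  have "(cube_avg I (\<lambda>Y. X Y * of_bool (X Y > 0)))\<^sup>2 \<le> s * q"
    using cube_avg_Cauchy_Schwarz[of I X "\<lambda>Y. of_bool (X Y > 0)"]
    by (simp add: s_def q_def power2_eq_square[of "of_bool _"] flip: of_bool_conj)
  moreover have "s\<^sup>2 \<le> (4 * l * cube_avg I (\<lambda>Y. X Y * of_bool (X Y > 0)))\<^sup>2"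
    using abs_large s unfolding abs_eq by (intro power_mono) auto
  ultimately have "s\<^sup>2 \<le> 16 * l\<^sup>2 * (s * q)"
    using mult_left_mono[of _ "s * q" "16 * l\<^sup>2"] by (fastforce simp: power_mult_distrib)
  then have "1 \<le> 2592 * q"
    using s unfolding l(2) by (simp add: power2_eq_square)
  moreover have "q = real (card {Y \<in> Pow I. X Y > 0}) / 2 ^ card I"
    using fin sum_of_bool_eq[of "Pow I" "\<lambda>Y. X Y > 0"]
    by (simp add: q_def cube_avg_def Collect_conj_eq Pow_def)
  ultimately show ?thesis by (simp add: field_simps)
qed

section \<open>Irregular scores in random tournaments\<close>

definition arc_sign :: "'a pair_pre_digraph \<Rightarrow> 'a \<Rightarrow> 'a \<Rightarrow> real" where
  "arc_sign H u v = of_bool ((u, v) \<in> parcs H) - of_bool ((v, u) \<in> parcs H)"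

definition imbalance :: "'a pair_pre_digraph \<Rightarrow> 'a \<Rightarrow> real" where
  "imbalance H u = (\<Sum>v\<in>pverts H. arc_sign H u v)"

text \<open>
  The excess of the squared imbalances over \<open>h (h - 1)\<close>, their mean in a random tournament on \<open>h\<close>
  vertices.
\<close>
definition score_excess :: "'a pair_pre_digraph \<Rightarrow> real" where
  "score_excess H = (\<Sum>u\<in>pverts H. (imbalance H u)\<^sup>2)
     - real (card (pverts H)) * (real (card (pverts H)) - 1)"

definition pair_of :: "nat \<Rightarrow> nat \<Rightarrow> nat \<times> nat" where
  "pair_of u v = (min u v, max u v)"

definition order_sign :: "nat \<Rightarrow> nat \<Rightarrow> real" where
  "order_sign u v = (if u < v then 1 else if v < u then -1 else 0)"

abbreviation tournament_of :: "nat \<Rightarrow> (nat \<times> nat) set \<Rightarrow> nat pair_pre_digraph" where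
  "tournament_of h Y \<equiv> oriented h (\<lambda>e. e \<in> Y)"

lemma pverts_oriented [simp]: "pverts (oriented h \<omega>) = {1..h}"
  by (simp add: oriented_def)

lemma finite_vertex_pairs [simp]: "finite (vertex_pairs h)"
  by (rule finite_subset[of _ "{1..h} \<times> {1..h}"]) (auto simp: vertex_pairs_def)

lemma arc_sign_tournament_of:
  assumes "u \<in> {1..h}" "v \<in> {1..h}"
  shows "arc_sign (tournament_of h Y) u v = order_sign u v * coin (pair_of u v) Y"
  using assms
  by (cases u v rule: linorder_cases)
     (auto simp: arc_sign_def order_sign_def coin_def pair_of_def oriented_def vertex_pairs_def)

text \<open>
  In \<open>(imbalance u)\<^sup>2\<close> the \<open>h - 1\<close> diagonal terms equal \<open>1\<close>; their total is precisely the subtracted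
  \<open>h (h - 1)\<close>. What remains are products of two different coins whose pairs share the vertex \<open>u\<close>.
\<close>
lemma score_excess_as_cherries:
  defines "C \<equiv> \<lambda>h. SIGMA u:{1..h}. SIGMA v:{1..h} - {u}. {1..h} - {u} - {v}"
  shows "score_excess (tournament_of h Y)
    = (\<Sum>(u, v, w)\<in>C h. order_sign u v * order_sign u w * walsh {pair_of u v, pair_of u w} Y)"
proof -
  define f where "f u v = order_sign u v * coin (pair_of u v) Y" for u v
  have ff: "f u v * f u v = 1" if "u \<noteq> v" for u v
    using that by (auto simp: f_def order_sign_def coin_def)
  have "(imbalance (tournament_of h Y) u)\<^sup>2
      = (real h - 1) + (\<Sum>v\<in>{1..h} - {u}. \<Sum>w\<in>{1..h} - {u} - {v}. f u v * f u w)"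
    if u: "u \<in> {1..h}" for u
  proof -
    have "imbalance (tournament_of h Y) u = (\<Sum>v\<in>{1..h}. f u v)"
      using u arc_sign_tournament_of by (simp add: imbalance_def f_def)
    also have "\<dots> = (\<Sum>v\<in>{1..h} - {u}. f u v)"
      using u by (intro sum.mono_neutral_right) (auto simp: f_def order_sign_def)
    finally have "(imbalance (tournament_of h Y) u)\<^sup>2
        = (\<Sum>v\<in>{1..h} - {u}. \<Sum>w\<in>{1..h} - {u}. f u v * f u w)"
      by (simp add: power2_eq_square sum_product)
    also have "\<dots> = (\<Sum>v\<in>{1..h} - {u}. 1 + (\<Sum>w\<in>{1..h} - {u} - {v}. f u v * f u w))"
      by (intro sum.cong refl) (subst sum.remove, auto simp: ff)
    also have "\<dots> = (real h - 1) + (\<Sum>v\<in>{1..h} - {u}. \<Sum>w\<in>{1..h} - {u} - {v}. f u v * f u w)"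
      using u by (simp add: sum.distrib of_nat_diff)
    finally show ?thesis .
  qed
  then have "(\<Sum>u\<in>{1..h}. (imbalance (tournament_of h Y) u)\<^sup>2)
      = real h * (real h - 1)
        + (\<Sum>u\<in>{1..h}. \<Sum>v\<in>{1..h} - {u}. \<Sum>w\<in>{1..h} - {u} - {v}. f u v * f u w)"
    by (simp add: sum.distrib)
  then have "score_excess (tournament_of h Y) = (\<Sum>(u, v, w)\<in>C h. f u v * f u w)"
    by (simp add: score_excess_def C_def sum.Sigma)
  also have "\<dots> = (\<Sum>(u, v, w)\<in>C h.
      order_sign u v * order_sign u w * walsh {pair_of u v, pair_of u w} Y)"
  proof (intro sum.cong refl, clarify)
    fix u v w assume "(u, v, w) \<in> C h"
    then have "pair_of u v \<noteq> pair_of u w"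
      by (auto simp: C_def pair_of_def min_def max_def split: if_splits)
    then show "f u v * f u w
        = order_sign u v * order_sign u w * walsh {pair_of u v, pair_of u w} Y"
      by (simp add: f_def walsh_def)
  qed
  finally show ?thesis .
qed

lemma score_excess_walsh_expansion:
  obtains a where "\<And>Y. score_excess (tournament_of h Y) = (\<Sum>S\<in>Pow (vertex_pairs h). a S * walsh S Y)"
    and "\<And>S. card S \<noteq> 2 \<Longrightarrow> a S = 0"
proof
  define C where "C = (SIGMA u:{1..h}. SIGMA v:{1..h} - {u}. {1..h} - {u} - {v})"
  define a where "a S = (\<Sum>(u, v, w)\<in>C. if {pair_of u v, pair_of u w} = S
      then order_sign u v * order_sign u w else 0)" for S
  have C: "pair_of u v \<noteq> pair_of u w" "{pair_of u v, pair_of u w} \<in> Pow (vertex_pairs h)"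
    if "(u, v, w) \<in> C" for u v w
    using that
    by (auto simp: C_def pair_of_def vertex_pairs_def min_def max_def split: if_splits)
  have "(\<Sum>S\<in>Pow (vertex_pairs h). a S * walsh S Y)
      = (\<Sum>S\<in>Pow (vertex_pairs h). \<Sum>(u, v, w)\<in>C. if {pair_of u v, pair_of u w} = S
          then order_sign u v * order_sign u w * walsh {pair_of u v, pair_of u w} Y else 0)" for Y
    unfolding a_def sum_distrib_right by (intro sum.cong refl) (auto split: if_splits)
  also have "\<dots> Y = (\<Sum>(u, v, w)\<in>C. \<Sum>S\<in>Pow (vertex_pairs h). if {pair_of u v, pair_of u w} = S
          then order_sign u v * order_sign u w * walsh {pair_of u v, pair_of u w} Y else 0)" for Y
    by (subst sum.swap) (simp add: case_prod_beta)
  also have "\<dots> Y = (\<Sum>(u, v, w)\<in>C.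
      order_sign u v * order_sign u w * walsh {pair_of u v, pair_of u w} Y)" for Y
    using C by (intro sum.cong refl) (auto simp: sum.delta)
  finally show "score_excess (tournament_of h Y) = (\<Sum>S\<in>Pow (vertex_pairs h). a S * walsh S Y)" for Y
    using score_excess_as_cherries[of h Y] by (simp add: C_def)
  show "a S = 0" if "card S \<noteq> 2" for S
    unfolding a_def using C(1) that by (intro sum.neutral) auto
qed

lemma sum_squares_arithmetic:
  fixes c :: real
  shows "3 * (\<Sum>u\<in>{1..k}. (c - 2 * real u)\<^sup>2)
    = 3 * k * c\<^sup>2 - 6 * c * k * (k + 1) + 2 * k * (k + 1) * (2 * k + 1)"
  by (induction k) (simp_all add: power2_eq_square algebra_simps)

text \<open>A witness that the score excess is not identically zero: the value here is \<open>h (h - 1) (h - 2) / 3\<close>.\<close>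
lemma score_excess_transitive:
  assumes "h \<ge> 3"
  shows "score_excess (tournament_of h (vertex_pairs h)) \<noteq> 0"
proof -
  have "imbalance (tournament_of h (vertex_pairs h)) u = (real h + 1) - 2 * real u"
    if u: "u \<in> {1..h}" for u
  proof -
    have "imbalance (tournament_of h (vertex_pairs h)) u
        = (\<Sum>v\<in>{1..h}. of_bool (u < v) - of_bool (v < u))"
      unfolding imbalance_def pverts_oriented using u
      by (intro sum.cong refl, subst arc_sign_tournament_of)
         (auto simp: order_sign_def coin_def pair_of_def vertex_pairs_def)
    also have "\<dots> = real (card ({1..h} \<inter> {v. u < v})) - real (card ({1..h} \<inter> {v. v < u}))"
      by (simp add: sum_subtractf sum_of_bool_eq)
    also have "\<dots> = real (card {u<..h}) - real (card {1..<u})"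
    proof -
      have "{1..h} \<inter> {v. u < v} = {u<..h}" "{1..h} \<inter> {v. v < u} = {1..<u}"
        using u by auto
      then show ?thesis by simp
    qed
    finally show ?thesis using u by (simp add: of_nat_diff)
  qed
  then have "3 * score_excess (tournament_of h (vertex_pairs h))
      = 3 * (\<Sum>u\<in>{1..h}. ((real h + 1) - 2 * real u)\<^sup>2) - 3 * (real h * (real h - 1))"
    by (simp add: score_excess_def)
  also have "\<dots> = real h * (real h - 1) * (real h - 2)"
    unfolding sum_squares_arithmetic by (simp add: power2_eq_square algebra_simps)
  finally show ?thesis using assms by auto
qed

lemma many_tournaments_with_score_excess:
  assumes "h \<ge> 3"
  shows "real (card {Y \<in> Pow (vertex_pairs h). score_excess (tournament_of h Y) > 0})
    \<ge> 2 ^ card (vertex_pairs h) / 2592"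
proof -
  obtain a where a: "\<And>Y. score_excess (tournament_of h Y)
      = (\<Sum>S\<in>Pow (vertex_pairs h). a S * walsh S Y)" "\<And>S. card S \<noteq> 2 \<Longrightarrow> a S = 0"
    using score_excess_walsh_expansion[of h] by metis
  show ?thesis
  proof (rule positive_part_large[where Y\<^sub>0 = "vertex_pairs h"])
    show "finite (vertex_pairs h)" "vertex_pairs h \<subseteq> vertex_pairs h" by simp_all
    show "cube_avg (vertex_pairs h) (\<lambda>Y. score_excess (tournament_of h Y)) = 0"
      unfolding a(1) by (subst cube_avg_walsh_sum) (auto intro: a(2))
    have "cube_avg (vertex_pairs h) (\<lambda>Y. score_excess (tournament_of h Y) ^ 4)
        \<le> 9 ^ 2 * (cube_avg (vertex_pairs h) (\<lambda>Y. (score_excess (tournament_of h Y))\<^sup>2))\<^sup>2"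
      unfolding a(1) by (rule Bonami_fourth_moment) (auto intro: a(2))
    then show "cube_avg (vertex_pairs h) (\<lambda>Y. score_excess (tournament_of h Y) ^ 4)
        \<le> 81 * (cube_avg (vertex_pairs h) (\<lambda>Y. (score_excess (tournament_of h Y))\<^sup>2))\<^sup>2"
      by simp
    show "score_excess (tournament_of h (vertex_pairs h)) \<noteq> 0"
      by (rule score_excess_transitive[OF assms])
  qed
qed

definition transitive_order :: "nat pair_pre_digraph \<Rightarrow> (nat \<Rightarrow> nat) \<Rightarrow> bool" where
  "transitive_order H \<sigma> \<longleftrightarrow> \<sigma> permutes pverts H \<and> (\<forall>(u, v)\<in>parcs H. \<sigma> u < \<sigma> v)"

text \<open>An ordering with all arcs forwards determines the tournament.\<close>
lemma few_transitive_tournaments: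
  "card {Y \<in> Pow (vertex_pairs h). \<exists>\<sigma>. transitive_order (tournament_of h Y) \<sigma>} \<le> fact h"
proof -
  define Z where "Z \<sigma> = {(i, j) \<in> vertex_pairs h. \<sigma> i < \<sigma> j}" for \<sigma> :: "nat \<Rightarrow> nat"
  have "Y = Z \<sigma>" if "Y \<subseteq> vertex_pairs h" "transitive_order (tournament_of h Y) \<sigma>" for Y \<sigma>
  proof -
    have "(i, j) \<in> Y \<longleftrightarrow> \<sigma> i < \<sigma> j" if ij: "(i, j) \<in> vertex_pairs h" for i j
    proof (cases "(i, j) \<in> Y")
      case True
      then have "(i, j) \<in> parcs (tournament_of h Y)" using ij by (auto simp: oriented_def)
      then show ?thesis using True \<open>transitive_order _ _\<close>
        by (auto simp: transitive_order_def)
    next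
      case False
      then have "(j, i) \<in> parcs (tournament_of h Y)" using ij by (auto simp: oriented_def)
      then have "\<sigma> j < \<sigma> i" using \<open>transitive_order _ _\<close>
        by (auto simp: transitive_order_def)
      then show ?thesis using False by simp
    qed
    then show ?thesis using that(1) unfolding Z_def by blast
  qed
  then have "{Y \<in> Pow (vertex_pairs h). \<exists>\<sigma>. transitive_order (tournament_of h Y) \<sigma>}
      \<subseteq> Z ` {\<sigma>. \<sigma> permutes {1..h}}"
    by (auto simp: transitive_order_def)
  then have "card {Y \<in> Pow (vertex_pairs h). \<exists>\<sigma>. transitive_order (tournament_of h Y) \<sigma>}
      \<le> card (Z ` {\<sigma>. \<sigma> permutes {1..h}})"
    by (intro card_mono finite_imageI finite_permutations) auto
  also have "\<dots> \<le> card {\<sigma>. \<sigma> permutes {1..h}}"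
    by (intro card_image_le finite_permutations) auto
  finally show ?thesis by (simp add: card_permutations)
qed

lemma vertex_pairs_Suc: "vertex_pairs (Suc h) = vertex_pairs h \<union> (\<lambda>i. (i, Suc h)) ` {1..h}"
  by (auto simp: vertex_pairs_def)

lemma card_vertex_pairs_Suc: "card (vertex_pairs (Suc h)) = card (vertex_pairs h) + h"
proof -
  have "inj_on (\<lambda>i. (i, Suc h)) {1..h}" by (auto simp: inj_on_def)
  moreover have "vertex_pairs h \<inter> (\<lambda>i. (i, Suc h)) ` {1..h} = {}" by (auto simp: vertex_pairs_def)
  ultimately show ?thesis
    unfolding vertex_pairs_Suc by (subst card_Un_disjoint) (auto simp: card_image)
qed

lemma card_vertex_pairs: "card (vertex_pairs h) = h choose 2"
proof (induction h)
  case 0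
  have "vertex_pairs 0 = {}" by (auto simp: vertex_pairs_def)
  then show ?case by simp
qed (simp add: card_vertex_pairs_Suc numeral_2_eq_2)


text \<open>
  Passing from \<open>h\<close> to \<open>h + 1\<close> multiplies the factorial by \<open>h + 1\<close> but the number of tournaments by
  \<open>2^h\<close>; the factor \<open>2^h\<close> on the left records the gain from the last step alone.
\<close>
lemma factorial_negligible:
  assumes "h \<ge> 1"
  shows "real (fact h) * 2 ^ h \<le> 2 * real h * 2 ^ card (vertex_pairs h)"
  using assms
proof (induction h rule: nat_induct_at_least)
  case base
  then show ?case by simp
next
  case (Suc h)
  have "h \<le> 2 ^ (h - 1)"
    using less_exp[of "h - 1"] Suc.hyps by (cases h) (auto simp: Suc_le_eq)
  then have "real h \<le> 2 ^ (h - 1)"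
    using of_nat_le_iff by fastforce
  then have h: "2 * real h \<le> 2 ^ h"
    using Suc.hyps by (cases h) auto
  have "real (fact (Suc h)) * 2 ^ Suc h = 2 * real (Suc h) * (real (fact h) * 2 ^ h)"
    by (simp add: algebra_simps)
  also have "\<dots> \<le> 2 * real (Suc h) * (2 * real h * 2 ^ card (vertex_pairs h))"
    using Suc.IH by (intro mult_left_mono) auto
  also have "\<dots> \<le> 2 * real (Suc h) * (2 ^ h * 2 ^ card (vertex_pairs h))"
    using h by (intro mult_left_mono mult_right_mono) auto
  also have "\<dots> = 2 * real (Suc h) * 2 ^ card (vertex_pairs (Suc h))"
    by (simp add: card_vertex_pairs_Suc power_add)
  finally show ?case .
qed

lemma eventually_factorial_small:
  "eventually (\<lambda>h. real (fact h) \<le> 2 ^ card (vertex_pairs h) / 5184) at_top"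
proof -
  have "eventually (\<lambda>h::nat. 2 * real h / 2 ^ h \<le> 1 / 5184) at_top" by real_asymp
  moreover have "eventually (\<lambda>h::nat. h \<ge> 1) at_top" by (rule eventually_ge_at_top)
  ultimately show ?thesis
  proof eventually_elim
    case (elim h)
    have "real (fact h) \<le> 2 * real h / 2 ^ h * 2 ^ card (vertex_pairs h)"
      using factorial_negligible[OF elim(2)] by (simp add: field_simps)
    also have "\<dots> \<le> 1 / 5184 * 2 ^ card (vertex_pairs h)"
      using elim(1) by (intro mult_right_mono) auto
    finally show ?case by simp
  qed
qed

lemma many_nontransitive_with_score_excess:
  "eventually (\<lambda>h. 2 ^ card (vertex_pairs h) / 5184 \<le> real (card {Y \<in> Pow (vertex_pairs h).
      score_excess (tournament_of h Y) > 0 \<and> (\<nexists>\<sigma>. transitive_order (tournament_of h Y) \<sigma>)})) at_top"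
  using eventually_factorial_small eventually_ge_at_top[of 3]
proof eventually_elim
  case (elim h)
  define A where "A = {Y \<in> Pow (vertex_pairs h). score_excess (tournament_of h Y) > 0}"
  define B where "B = {Y \<in> Pow (vertex_pairs h). \<exists>\<sigma>. transitive_order (tournament_of h Y) \<sigma>}"
  have "card A - card B \<le> card (A - B)"
    by (intro diff_card_le_card_Diff) (simp add: B_def)
  then have "real (card A) - real (card B) \<le> real (card (A - B))" by linarith
  moreover have "real (card B) \<le> real (fact h)"
    unfolding B_def using few_transitive_tournaments of_nat_le_iff by blast
  moreover have "real (card A) \<ge> 2 ^ card (vertex_pairs h) / 2592"
    unfolding A_def by (rule many_tournaments_with_score_excess[OF elim(2)])
  moreover have "A - B = {Y \<in> Pow (vertex_pairs h).
      score_excess (tournament_of h Y) > 0 \<and> (\<nexists>\<sigma>. transitive_order (tournament_of h Y) \<sigma>)}"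
    by (auto simp: A_def B_def)
  ultimately show ?case using elim(1) by simp
qed

section \<open>The order polynomial of a tournament\<close>

lemma order_sign_swap: "order_sign v u = - order_sign u v"
  by (simp add: order_sign_def)

lemma order_sign_square: "u \<noteq> v \<Longrightarrow> order_sign u v * order_sign u v = 1"
  by (simp add: order_sign_def)

text \<open>Relabelling two vertices is the only symmetry of random orders that the correlations below use.\<close>
lemma sum_permutes_transpose:
  fixes F :: "('a \<Rightarrow> 'a) \<Rightarrow> real"
  assumes "a \<in> V" "b \<in> V"
  shows "(\<Sum>\<sigma> | \<sigma> permutes V. F (\<sigma> \<circ> Transposition.transpose a b)) = (\<Sum>\<sigma> | \<sigma> permutes V. F \<sigma>)"
  by (rule sum_permutations_compose_right[OF permutes_swap_id[OF assms], symmetric])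

lemma sum_order_sign:
  assumes "u \<in> V" "v \<in> V"
  shows "(\<Sum>\<sigma> | \<sigma> permutes V. order_sign (\<sigma> u) (\<sigma> v)) = 0"
  using sum_permutes_transpose[OF assms, of "\<lambda>\<sigma>. order_sign (\<sigma> u) (\<sigma> v)"]
  by (simp add: order_sign_swap[of "_ v"] sum_negf)

lemma sum_order_sign_disjoint:
  assumes "u \<in> V" "v \<in> V" "x \<notin> {u, v}" "y \<notin> {u, v}"
  shows "(\<Sum>\<sigma> | \<sigma> permutes V. order_sign (\<sigma> u) (\<sigma> v) * order_sign (\<sigma> x) (\<sigma> y)) = 0"
  using sum_permutes_transpose[OF assms(1,2),
      of "\<lambda>\<sigma>. order_sign (\<sigma> u) (\<sigma> v) * order_sign (\<sigma> x) (\<sigma> y)"] assms(3,4)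
  by (simp add: order_sign_swap[of "_ v"] sum_negf transpose_apply_other)

text \<open>
  Among three vertices in random order, the two comparisons made at a vertex agree unless that vertex
  is the middle one. The three cherries thus always sum to \<open>1 + 1 - 1\<close>, and by symmetry each of
  them has mean \<open>1 / 3\<close>.
\<close>
lemma sum_order_sign_cherry:
  assumes V: "finite V" "u \<in> V" "v \<in> V" "w \<in> V" and ne: "u \<noteq> v" "u \<noteq> w" "v \<noteq> w"
  shows "3 * (\<Sum>\<sigma> | \<sigma> permutes V. order_sign (\<sigma> u) (\<sigma> v) * order_sign (\<sigma> u) (\<sigma> w))
    = fact (card V)"
proof -
  let ?c = "\<lambda>a b c \<sigma>. order_sign (\<sigma> a) (\<sigma> b) * order_sign (\<sigma> a) (\<sigma> c)"
  have v: "(\<Sum>\<sigma> | \<sigma> permutes V. ?c v u w \<sigma>) = (\<Sum>\<sigma> | \<sigma> permutes V. ?c u v w \<sigma>)"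
    using sum_permutes_transpose[OF V(2,3), of "?c u v w"] ne
    by (simp add: transpose_apply_other)
  have w: "(\<Sum>\<sigma> | \<sigma> permutes V. ?c w v u \<sigma>) = (\<Sum>\<sigma> | \<sigma> permutes V. ?c u v w \<sigma>)"
    using sum_permutes_transpose[OF V(2,4), of "?c u v w"] ne
    by (simp add: transpose_apply_other)
  have "(\<Sum>\<sigma> | \<sigma> permutes V. ?c u v w \<sigma> + ?c v u w \<sigma> + ?c w v u \<sigma>)
      = (\<Sum>\<sigma> | \<sigma> permutes V. 1)"
  proof (intro sum.cong refl)
    fix \<sigma> :: "nat \<Rightarrow> nat" assume "\<sigma> \<in> {\<sigma>. \<sigma> permutes V}"
    then have "\<sigma> u \<noteq> \<sigma> v" "\<sigma> u \<noteq> \<sigma> w" "\<sigma> v \<noteq> \<sigma> w"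
      using ne by (auto dest!: permutes_inj simp: inj_eq)
    then show "?c u v w \<sigma> + ?c v u w \<sigma> + ?c w v u \<sigma> = 1"
      by (auto simp: order_sign_def)
  qed
  then show ?thesis
    unfolding sum.distrib v w using card_permutations[OF refl V(1)] by simp
qed

text \<open>
  A single formula for the correlation of two comparisons. It subsumes equal pairs (\<open>1\<close> or \<open>-1\<close>),
  pairs sharing one vertex (\<open>1/3\<close> or \<open>-1/3\<close>) and disjoint pairs (\<open>0\<close>), so that quadratic forms can
  be summed without a case distinction.
\<close>
lemma sum_order_sign_pairs:
  assumes V: "finite V" "u \<in> V" "v \<in> V" "x \<in> V" "y \<in> V" and ne: "u \<noteq> v" "x \<noteq> y"
  shows "3 * (\<Sum>\<sigma> | \<sigma> permutes V. order_sign (\<sigma> u) (\<sigma> v) * order_sign (\<sigma> x) (\<sigma> y))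
    = fact (card V) * (of_bool (u = x) - of_bool (u = y) - of_bool (v = x) + of_bool (v = y)
        + of_bool (u = x \<and> v = y) - of_bool (u = y \<and> v = x))"
proof -
  have same: "(\<Sum>\<sigma> | \<sigma> permutes V. order_sign (\<sigma> u) (\<sigma> v) * order_sign (\<sigma> u) (\<sigma> v))
      = fact (card V)"
  proof -
    have "order_sign (\<sigma> u) (\<sigma> v) * order_sign (\<sigma> u) (\<sigma> v) = 1" if "\<sigma> permutes V" for \<sigma>
      using that ne(1) by (intro order_sign_square) (auto dest!: permutes_inj simp: inj_eq)
    then show ?thesis using card_permutations[OF refl V(1)] by simp
  qed
  consider "u = x" "v = y" | "u = x" "v \<noteq> y" | "u = y" "v = x" | "u = y" "v \<noteq> x"
    | "v = x" "u \<noteq> y" | "v = y" "u \<noteq> x" | "x \<notin> {u, v}" "y \<notin> {u, v}"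
    by auto
  then show ?thesis
  proof cases
    case 1
    then show ?thesis using same ne by simp
  next
    case 2
    then show ?thesis using sum_order_sign_cherry[of V u v y] V ne by simp
  next
    case 3
    then show ?thesis using same ne by (simp add: order_sign_swap[of "_ x" "_ y"] sum_negf)
  next
    case 4
    then show ?thesis using sum_order_sign_cherry[of V u v x] V ne
      by (simp add: order_sign_swap[of "_ x" "_ y"] sum_negf)
  next
    case 5
    then show ?thesis using sum_order_sign_cherry[of V v u y] V ne
      by (simp add: order_sign_swap[of "_ u" "_ x"] sum_negf)
  next
    case 6
    then show ?thesis using sum_order_sign_cherry[of V v u x] V ne
      by (simp add: order_sign_swap[of "_ u" "_ y"] order_sign_swap[of "_ x" "_ y"])
  next
    case 7
    then show ?thesis using sum_order_sign_disjoint[of u V v x y] V by simp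
  qed
qed

lemma second_moment_antisymmetric_form:
  fixes f :: "nat \<Rightarrow> nat \<Rightarrow> real"
  assumes V: "finite V" and anti: "\<And>u v. f v u = - f u v"
  shows "3 * (\<Sum>\<sigma> | \<sigma> permutes V. (\<Sum>u\<in>V. \<Sum>v\<in>V. f u v * order_sign (\<sigma> u) (\<sigma> v))\<^sup>2)
    = fact (card V) * (4 * (\<Sum>u\<in>V. (\<Sum>v\<in>V. f u v)\<^sup>2) + 2 * (\<Sum>u\<in>V. \<Sum>v\<in>V. (f u v)\<^sup>2))"
proof -
  let ?k = "\<lambda>u v x y. of_bool (u = x) - of_bool (u = y) - of_bool (v = x) + of_bool (v = y)
        + of_bool (u = x \<and> v = y) - of_bool (u = y \<and> v = x) :: real"
  have diag: "f u u = 0" for u using anti[of u u] by simp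
  have "3 * (\<Sum>\<sigma> | \<sigma> permutes V. (\<Sum>u\<in>V. \<Sum>v\<in>V. f u v * order_sign (\<sigma> u) (\<sigma> v))\<^sup>2)
      = 3 * (\<Sum>\<sigma> | \<sigma> permutes V. \<Sum>u\<in>V. \<Sum>v\<in>V. \<Sum>x\<in>V. \<Sum>y\<in>V.
          f u v * f x y * (order_sign (\<sigma> u) (\<sigma> v) * order_sign (\<sigma> x) (\<sigma> y)))"
    unfolding power2_eq_square sum_distrib_right unfolding sum_distrib_left
    by (intro sum.cong refl) (simp only: mult_ac)
  also have "\<dots> = (\<Sum>u\<in>V. \<Sum>v\<in>V. \<Sum>x\<in>V. \<Sum>y\<in>V. f u v * f x y *
      (3 * (\<Sum>\<sigma> | \<sigma> permutes V. order_sign (\<sigma> u) (\<sigma> v) * order_sign (\<sigma> x) (\<sigma> y))))"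
    by (simp add: sum.swap[of _ V "{\<sigma>. \<sigma> permutes V}"] sum_distrib_left mult_ac)
  also have "\<dots> = (\<Sum>u\<in>V. \<Sum>v\<in>V. \<Sum>x\<in>V. \<Sum>y\<in>V. f u v * f x y * (fact (card V) * ?k u v x y))"
  proof (intro sum.cong refl)
    fix u v x y assume "u \<in> V" "v \<in> V" "x \<in> V" "y \<in> V"
    then have "f u v * f x y = 0 \<or>
        3 * (\<Sum>\<sigma> | \<sigma> permutes V. order_sign (\<sigma> u) (\<sigma> v) * order_sign (\<sigma> x) (\<sigma> y))
          = fact (card V) * ?k u v x y"
      using sum_order_sign_pairs[OF V, of u v x y] diag by (cases "u = v \<or> x = y") fastforce+
    then show "f u v * f x y *
      (3 * (\<Sum>\<sigma> | \<sigma> permutes V. order_sign (\<sigma> u) (\<sigma> v) * order_sign (\<sigma> x) (\<sigma> y)))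
      = f u v * f x y * (fact (card V) * ?k u v x y)"
      by (elim disjE) (simp_all only: mult_zero_left)
  qed
  also have "\<dots> = fact (card V) * (\<Sum>u\<in>V. \<Sum>v\<in>V. \<Sum>x\<in>V. \<Sum>y\<in>V. f u v * f x y * ?k u v x y)"
    unfolding sum_distrib_left by (intro sum.cong refl) (simp only: mult_ac)
  also have "(\<Sum>u\<in>V. \<Sum>v\<in>V. \<Sum>x\<in>V. \<Sum>y\<in>V. f u v * f x y * ?k u v x y)
      = 4 * (\<Sum>u\<in>V. (\<Sum>v\<in>V. f u v)\<^sup>2) + 2 * (\<Sum>u\<in>V. \<Sum>v\<in>V. (f u v)\<^sup>2)"
  proof -
    define D where "D u = (\<Sum>v\<in>V. f u v)" for u
    have D': "(\<Sum>v\<in>V. f v u) = - D u" for u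
      unfolding D_def sum_negf[symmetric] by (intro sum.cong refl) (rule anti)
    have pick: "(\<Sum>x\<in>V. of_bool (c = x) * g x) = g c" if "c \<in> V" for c and g :: "nat \<Rightarrow> real"
      using V that by (simp add: of_bool_def if_distrib[of "\<lambda>z. z * _"] sum.delta cong: if_cong)
    have inner: "(\<Sum>x\<in>V. \<Sum>y\<in>V. f u v * f x y * ?k u v x y)
        = 2 * (f u v * D u) - 2 * (f u v * D v) + 2 * (f u v)\<^sup>2" if "u \<in> V" "v \<in> V" for u v
    proof -
      have row: "(\<Sum>x\<in>V. \<Sum>y\<in>V. of_bool (c = x) * f x y) = D c" if "c \<in> V" for c
        using pick[OF that, of D] by (simp add: D_def sum_distrib_left)
      have col: "(\<Sum>x\<in>V. \<Sum>y\<in>V. of_bool (c = y) * f x y) = - D c" if "c \<in> V" for c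
        using pick[OF that] D' by simp
      have entry: "(\<Sum>x\<in>V. \<Sum>y\<in>V. of_bool (c = x \<and> d = y) * f x y) = f c d"
        if "c \<in> V" "d \<in> V" for c d
        using that by (simp add: of_bool_conj mult.assoc pick flip: sum_distrib_left)
      have entry': "(\<Sum>x\<in>V. \<Sum>y\<in>V. of_bool (c = y \<and> d = x) * f x y) = f d c"
        if "c \<in> V" "d \<in> V" for c d
        using entry[OF that(2,1)] by (simp add: conj_commute)
      have "(\<Sum>x\<in>V. \<Sum>y\<in>V. f u v * f x y * ?k u v x y)
          = f u v * (\<Sum>x\<in>V. \<Sum>y\<in>V. of_bool (u = x) * f x y - of_bool (u = y) * f x y
              - of_bool (v = x) * f x y + of_bool (v = y) * f x y
              + of_bool (u = x \<and> v = y) * f x y - of_bool (u = y \<and> v = x) * f x y)"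
        by (simp add: sum_distrib_left algebra_simps)
      also have "\<dots> = f u v * (D u + D u - D v - D v + f u v - f v u)"
        using \<open>u \<in> V\<close> \<open>v \<in> V\<close>
        by (simp only: sum.distrib sum_subtractf row col entry entry'
            diff_minus_eq_add add_uminus_conv_diff)
      also have "\<dots> = 2 * (f u v * D u) - 2 * (f u v * D v) + 2 * (f u v)\<^sup>2"
        by (simp add: anti[of v u] power2_eq_square algebra_simps)
      finally show ?thesis .
    qed
    have 1: "(\<Sum>u\<in>V. \<Sum>v\<in>V. f u v * D u) = (\<Sum>u\<in>V. (D u)\<^sup>2)"
      by (simp add: power2_eq_square D_def flip: sum_distrib_right)
    have 2: "(\<Sum>u\<in>V. \<Sum>v\<in>V. f u v * D v) = - (\<Sum>u\<in>V. (D u)\<^sup>2)"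
      by (subst sum.swap) (simp add: power2_eq_square D' sum_negf flip: sum_distrib_right)
    show ?thesis
      by (simp add: inner sum.distrib sum_subtractf 1 2 flip: sum_distrib_left)
         (simp add: D_def)
  qed
  finally show ?thesis .
qed

text \<open>
  As \<open>s e\<^sup>2 = 1\<close>, the second elementary symmetric function of the signs is
  \<open>((\<Sum>e. s e)\<^sup>2 - card E) / 2\<close>.
\<close>
lemma prod_second_order_expansion:
  fixes s :: "'a \<Rightarrow> real"
  assumes "finite E" and "\<And>e. e \<in> E \<Longrightarrow> \<bar>s e\<bar> = 1"
  shows "\<exists>C\<ge>0. \<forall>t\<in>{0..1}. \<bar>(\<Prod>e\<in>E. 1 + t * s e)
    - (1 + t * sum s E + t\<^sup>2 / 2 * ((sum s E)\<^sup>2 - card E))\<bar> \<le> C * t ^ 3"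
  using assms
proof (induction E rule: finite_induct)
  case empty
  show ?case by (intro exI[of _ 0]) simp
next
  case (insert e E)
  define S where "S = sum s E"
  define m where "m = real (card E)"
  obtain C where C: "C \<ge> 0" "\<And>t. t \<in> {0..1} \<Longrightarrow>
      \<bar>(\<Prod>e\<in>E. 1 + t * s e) - (1 + t * S + t\<^sup>2 / 2 * (S\<^sup>2 - m))\<bar> \<le> C * t ^ 3"
    using insert unfolding S_def m_def by auto
  have se: "\<bar>s e\<bar> = 1" "s e * s e = 1"
    using insert.prems[of e] by (auto simp: abs_if split: if_splits)
  show ?case
  proof (intro exI[of _ "\<bar>S\<^sup>2 - m\<bar> / 2 + 2 * C"] conjI ballI)
    show "0 \<le> \<bar>S\<^sup>2 - m\<bar> / 2 + 2 * C" using C(1) by simp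
    fix t :: real assume t: "t \<in> {0..1}"
    define P where "P = (\<Prod>e\<in>E. 1 + t * s e)"
    define Q where "Q = 1 + t * S + t\<^sup>2 / 2 * (S\<^sup>2 - m)"
    have "(\<Prod>e\<in>insert e E. 1 + t * s e) = (1 + t * s e) * P"
      using insert.hyps by (simp add: P_def)
    moreover have "sum s (insert e E) = s e + S" "real (card (insert e E)) = m + 1"
      using insert.hyps by (simp_all add: S_def m_def)
    moreover have "(1 + t * s e) * P - (1 + t * (s e + S) + t\<^sup>2 / 2 * ((s e + S)\<^sup>2 - (m + 1)))
        = t ^ 3 * (s e * (S\<^sup>2 - m) / 2) + (1 + t * s e) * (P - Q)"
    proof -
      have "(s e + S)\<^sup>2 = S\<^sup>2 + 2 * (s e * S) + 1"
        using se(2) by (simp add: power2_eq_square algebra_simps)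
      moreover have "t\<^sup>2 * (s e * s e) = t\<^sup>2" using se(2) by simp
      ultimately show ?thesis
        unfolding Q_def by (simp add: power2_eq_square power3_eq_cube field_simps)
    qed
    moreover have "\<bar>t ^ 3 * (s e * (S\<^sup>2 - m) / 2) + (1 + t * s e) * (P - Q)\<bar>
        \<le> t ^ 3 * (\<bar>S\<^sup>2 - m\<bar> / 2) + 2 * (C * t ^ 3)"
    proof -
      have "\<bar>1 + t * s e\<bar> \<le> 2"
        using t se(1) by (auto simp: abs_if split: if_splits)
      then have "\<bar>(1 + t * s e) * (P - Q)\<bar> \<le> 2 * (C * t ^ 3)"
        unfolding abs_mult P_def Q_def by (intro mult_mono C(2)[OF t]) auto
      moreover have "\<bar>t ^ 3 * (s e * (S\<^sup>2 - m) / 2)\<bar> = t ^ 3 * (\<bar>S\<^sup>2 - m\<bar> / 2)"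
        using t se(1) by (simp add: abs_mult power_abs)
      ultimately show ?thesis by linarith
    qed
    ultimately show "\<bar>(\<Prod>e\<in>insert e E. 1 + t * s e) - (1 + t * sum s (insert e E)
        + t\<^sup>2 / 2 * ((sum s (insert e E))\<^sup>2 - real (card (insert e E))))\<bar>
        \<le> (\<bar>S\<^sup>2 - m\<bar> / 2 + 2 * C) * t ^ 3"
      by (simp add: algebra_simps)
  qed
qed


text \<open>
  Up to the factor \<open>2^(card (parcs H))\<close> this is the expected number of copies of \<open>H\<close> on a set of
  \<open>card (pverts H)\<close> vertices when pairs are oriented forwards with probability \<open>(1 + t) / 2\<close>.
\<close>
definition order_poly :: "nat pair_pre_digraph \<Rightarrow> real \<Rightarrow> real" where
  "order_poly H t =
    (\<Sum>\<sigma> | \<sigma> permutes pverts H. \<Prod>(u, v)\<in>parcs H. 1 + t * order_sign (\<sigma> u) (\<sigma> v))"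

context tournament
begin

lemma sum_arcs:
  fixes g :: "'a \<Rightarrow> 'a \<Rightarrow> real"
  shows "(\<Sum>u\<in>pverts T. \<Sum>v\<in>pverts T. of_bool ((u, v) \<in> parcs T) * g u v) = (\<Sum>(u, v)\<in>parcs T. g u v)"
proof -
  have "(\<Sum>u\<in>pverts T. \<Sum>v\<in>pverts T. of_bool ((u, v) \<in> parcs T) * g u v)
      = (\<Sum>e\<in>pverts T \<times> pverts T. of_bool (e \<in> parcs T) * (case e of (u, v) \<Rightarrow> g u v))"
    unfolding sum.cartesian_product by (intro sum.cong refl) auto
  also have "\<dots> = (\<Sum>e\<in>parcs T. of_bool (e \<in> parcs T) * (case e of (u, v) \<Rightarrow> g u v))"
    using pair_finite_verts
    by (intro sum.mono_neutral_right) (auto dest: in_arcsD1 in_arcsD2)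
  finally show ?thesis by (simp add: case_prod_beta)
qed

lemma sum_reversed_arcs:
  fixes g :: "'a \<Rightarrow> 'a \<Rightarrow> real"
  shows "(\<Sum>u\<in>pverts T. \<Sum>v\<in>pverts T. of_bool ((v, u) \<in> parcs T) * g u v) = (\<Sum>(u, v)\<in>parcs T. g v u)"
  by (subst sum.swap) (rule sum_arcs)

lemma arc_asym: "(u, v) \<in> parcs T \<Longrightarrow> (v, u) \<notin> parcs T"
  using exactly_one_arc[of u v] pair_no_loops[of "(u, v)"] by (auto dest: in_arcsD1 in_arcsD2)

lemma sum_arc_sign:
  fixes g :: "'a \<Rightarrow> 'a \<Rightarrow> real"
  assumes "\<And>u v. g v u = - g u v"
  shows "(\<Sum>u\<in>pverts T. \<Sum>v\<in>pverts T. arc_sign T u v * g u v) = 2 * (\<Sum>(u, v)\<in>parcs T. g u v)"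
proof -
  have "(\<Sum>(u, v)\<in>parcs T. g v u) = - (\<Sum>(u, v)\<in>parcs T. g u v)"
    unfolding sum_negf[symmetric] by (intro sum.cong refl) (auto intro: assms)
  then show ?thesis
    by (simp only: arc_sign_def left_diff_distrib sum_subtractf sum_arcs sum_reversed_arcs)
qed

lemma sum_arc_sign_square:
  "(\<Sum>u\<in>pverts T. \<Sum>v\<in>pverts T. (arc_sign T u v)\<^sup>2) = 2 * real (card (parcs T))"
proof -
  have "(arc_sign T u v)\<^sup>2 = of_bool ((u, v) \<in> parcs T) * 1 + of_bool ((v, u) \<in> parcs T) * 1" for u v
    using arc_asym[of u v] by (auto simp: arc_sign_def)
  then have "(\<Sum>u\<in>pverts T. \<Sum>v\<in>pverts T. (arc_sign T u v)\<^sup>2)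
      = (\<Sum>(u, v)\<in>parcs T. 1) + (\<Sum>(u, v)\<in>parcs T. 1)"
    by (simp only: sum.distrib sum_arcs sum_reversed_arcs)
  then show ?thesis by (simp add: case_prod_beta)
qed

lemma card_arcs: "2 * real (card (parcs T)) = real (card (pverts T)) * (real (card (pverts T)) - 1)"
proof -
  have sq: "(arc_sign T u v)\<^sup>2 = of_bool (v \<noteq> u)" if "u \<in> pverts T" "v \<in> pverts T" for u v
    using exactly_one_arc[OF that] pair_no_loops[of "(u, v)"] by (auto simp: arc_sign_def)
  have "(\<Sum>v\<in>pverts T. (arc_sign T u v)\<^sup>2) = real (card (pverts T)) - 1" if u: "u \<in> pverts T" for u
  proof -
    have "(\<Sum>v\<in>pverts T. (arc_sign T u v)\<^sup>2) = (\<Sum>v\<in>pverts T. of_bool (v \<noteq> u))"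
      using sq[OF u] by (intro sum.cong refl) auto
    also have "\<dots> = real (card (pverts T - {u}))"
      using pair_finite_verts by (simp add: sum_of_bool_eq Diff_eq Compl_eq)
    also have "\<dots> = real (card (pverts T)) - 1"
      using u pair_finite_verts card_gt_0_iff[of "pverts T"]
      by (subst card_Diff_singleton) (auto simp: of_nat_diff)
    finally show ?thesis .
  qed
  then show ?thesis by (simp add: sum_arc_sign_square[symmetric])
qed

end

text \<open>
  The expansion of \<open>order_poly H\<close> at \<open>0\<close> begins with \<open>h! + 0 * t + (A / 2) * t\<^sup>2\<close>, where the
  correlation formula identifies \<open>A\<close> as \<open>h! / 3\<close> times the score excess.
\<close>
lemma order_poly_exceeds_fact:
  assumes T: "tournament H" and excess: "score_excess H > 0"
  shows "\<exists>t\<in>{0<..<1}. order_poly H t > fact (card (pverts H))"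
proof -
  interpret tournament H by fact
  define V where "V = pverts H"
  define m where "m = real (card (parcs H))"
  define S where "S \<sigma> = (\<Sum>(u, v)\<in>parcs H. order_sign (\<sigma> u) (\<sigma> v))" for \<sigma> :: "nat \<Rightarrow> nat"
  have V: "finite V" unfolding V_def by (rule pair_finite_verts)
  have perms: "finite {\<sigma>. \<sigma> permutes V}" by (rule finite_permutations[OF V])
  have card_perms: "real (card {\<sigma>. \<sigma> permutes V}) = fact (card V)"
    using card_permutations[OF refl V] by simp
  have first: "(\<Sum>\<sigma> | \<sigma> permutes V. S \<sigma>) = 0"
  proof -
    have "(\<Sum>\<sigma> | \<sigma> permutes V. S \<sigma>)
        = (\<Sum>e\<in>parcs H. \<Sum>\<sigma> | \<sigma> permutes V. order_sign (\<sigma> (fst e)) (\<sigma> (snd e)))"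
      unfolding S_def case_prod_beta by (rule sum.swap)
    also have "\<dots> = 0"
      by (intro sum.neutral ballI sum_order_sign)
         (auto simp: V_def arc_fst_in_verts arc_snd_in_verts)
    finally show ?thesis .
  qed
  have second: "(\<Sum>\<sigma> | \<sigma> permutes V. (S \<sigma>)\<^sup>2 - m) > 0"
  proof -
    have "(\<Sum>u\<in>V. \<Sum>v\<in>V. arc_sign H u v * order_sign (\<sigma> u) (\<sigma> v)) = 2 * S \<sigma>" for \<sigma>
      unfolding V_def S_def by (rule sum_arc_sign) (rule order_sign_swap)
    then have "12 * (\<Sum>\<sigma> | \<sigma> permutes V. (S \<sigma>)\<^sup>2)
        = 3 * (\<Sum>\<sigma> | \<sigma> permutes V. (\<Sum>u\<in>V. \<Sum>v\<in>V. arc_sign H u v * order_sign (\<sigma> u) (\<sigma> v))\<^sup>2)"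
      by (simp add: power_mult_distrib flip: sum_distrib_left)
    also have "\<dots> = fact (card V) * (4 * (\<Sum>u\<in>V. (imbalance H u)\<^sup>2) + 4 * m)"
    proof -
      have anti: "arc_sign H v u = - arc_sign H u v" for u v by (simp add: arc_sign_def)
      have square: "(\<Sum>u\<in>V. \<Sum>v\<in>V. (arc_sign H u v)\<^sup>2) = 2 * m"
        unfolding V_def m_def by (rule sum_arc_sign_square)
      have imb: "imbalance H u = (\<Sum>v\<in>V. arc_sign H u v)" for u
        by (simp add: imbalance_def V_def)
      show ?thesis
        unfolding second_moment_antisymmetric_form[OF V, of "arc_sign H", OF anti] square imb
        by simp
    qed
    also have "(\<Sum>u\<in>V. (imbalance H u)\<^sup>2) = score_excess H + 2 * m"
      unfolding score_excess_def V_def m_def card_arcs by simp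
    finally have "12 * (\<Sum>\<sigma> | \<sigma> permutes V. (S \<sigma>)\<^sup>2)
        = fact (card V) * (4 * (score_excess H + 2 * m) + 4 * m)" .
    then have "12 * (\<Sum>\<sigma> | \<sigma> permutes V. (S \<sigma>)\<^sup>2)
        = 4 * (fact (card V) * score_excess H) + 12 * (fact (card V) * m)"
      by (simp only: distrib_left mult.left_commute[of "fact _"])
    moreover have "fact (card V) * score_excess H > (0::real)"
      using excess by simp
    ultimately have "(\<Sum>\<sigma> | \<sigma> permutes V. (S \<sigma>)\<^sup>2) - fact (card V) * m > 0"
      by linarith
    then show ?thesis
      by (simp add: sum_subtractf card_perms)
  qed
  define A where "A = (\<Sum>\<sigma> | \<sigma> permutes V. (S \<sigma>)\<^sup>2 - m)"
  have "\<exists>C\<ge>0. \<forall>t\<in>{0..1}. \<bar>(\<Prod>(u, v)\<in>parcs H. 1 + t * order_sign (\<sigma> u) (\<sigma> v))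
      - (1 + t * S \<sigma> + t\<^sup>2 / 2 * ((S \<sigma>)\<^sup>2 - m))\<bar> \<le> C * t ^ 3" if "\<sigma> permutes V" for \<sigma>
    unfolding S_def m_def case_prod_beta
  proof (rule prod_second_order_expansion[OF pair_finite_arcs])
    fix e assume "e \<in> parcs H"
    then have "\<sigma> (fst e) \<noteq> \<sigma> (snd e)"
      using that pair_no_loops by (auto dest!: permutes_inj simp: inj_eq)
    then show "\<bar>order_sign (\<sigma> (fst e)) (\<sigma> (snd e))\<bar> = 1" by (simp add: order_sign_def)
  qed
  then obtain C where C: "\<And>\<sigma>. \<sigma> permutes V \<Longrightarrow> C \<sigma> \<ge> 0"
    "\<And>\<sigma> t. \<sigma> permutes V \<Longrightarrow> t \<in> {0..1} \<Longrightarrow>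
      \<bar>(\<Prod>(u, v)\<in>parcs H. 1 + t * order_sign (\<sigma> u) (\<sigma> v))
      - (1 + t * S \<sigma> + t\<^sup>2 / 2 * ((S \<sigma>)\<^sup>2 - m))\<bar> \<le> C \<sigma> * t ^ 3"
    by metis
  define K where "K = (\<Sum>\<sigma> | \<sigma> permutes V. C \<sigma>)"
  have K: "K \<ge> 0" unfolding K_def by (intro sum_nonneg) (simp add: C(1))
  have lower: "order_poly H t \<ge> fact (card V) + t\<^sup>2 * (A / 2 - K * t)" if t: "t \<in> {0..1}" for t
  proof -
    have "(\<Sum>\<sigma> | \<sigma> permutes V. 1 + t * S \<sigma> + t\<^sup>2 / 2 * ((S \<sigma>)\<^sup>2 - m) - C \<sigma> * t ^ 3)
        \<le> order_poly H t"
      unfolding order_poly_def V_def[symmetric]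
    proof (intro sum_mono)
      fix \<sigma> assume "\<sigma> \<in> {\<sigma>. \<sigma> permutes V}"
      then show "1 + t * S \<sigma> + t\<^sup>2 / 2 * ((S \<sigma>)\<^sup>2 - m) - C \<sigma> * t ^ 3
          \<le> (\<Prod>(u, v)\<in>parcs H. 1 + t * order_sign (\<sigma> u) (\<sigma> v))"
        using C(2)[of \<sigma> t] t unfolding abs_le_iff by simp
    qed
    also have "(\<Sum>\<sigma> | \<sigma> permutes V. 1 + t * S \<sigma> + t\<^sup>2 / 2 * ((S \<sigma>)\<^sup>2 - m) - C \<sigma> * t ^ 3)
        = fact (card V) + t * (\<Sum>\<sigma> | \<sigma> permutes V. S \<sigma>) + t\<^sup>2 / 2 * A - K * t ^ 3"
      unfolding A_def K_def sum_distrib_left sum_distrib_right card_perms[symmetric]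
      by (simp only: sum.distrib sum_subtractf) simp
    also have "\<dots> = fact (card V) + t\<^sup>2 * (A / 2 - K * t)"
      unfolding first by (simp add: power2_eq_square power3_eq_cube algebra_simps)
    finally show ?thesis .
  qed
  \<comment> \<open>Small enough for the cubic error to use up at most half of the quadratic gain.\<close>
  define t where "t = min (1 / 2) (A / (4 * (K + 1)))"
  have A: "A > 0" unfolding A_def by (rule second)
  have t: "0 < t" "t \<le> 1 / 2" "t \<le> A / (4 * (K + 1))"
    using A K unfolding t_def by simp (rule min.cobounded1, rule min.cobounded2)
  have "K * t \<le> (K + 1) * (A / (4 * (K + 1)))"
    by (rule mult_mono[OF _ t(3)]) (use K t(1) in linarith)+
  also have "\<dots> = A / 4" using K by (simp add: field_simps)
  finally have "A / 2 - K * t > 0" using A by linarith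
  then have "t\<^sup>2 * (A / 2 - K * t) > 0" using t(1) by simp
  then have "order_poly H t > fact (card V)" using lower[of t] t by simp
  then show ?thesis using t by (intro bexI[of _ t]) (auto simp: V_def)
qed

text \<open>At \<open>t = 1\<close> every backward arc contributes a factor \<open>0\<close>.\<close>
lemma order_poly_one_nontransitive:
  assumes T: "tournament H" and nontrans: "\<nexists>\<sigma>. transitive_order H \<sigma>"
  shows "order_poly H 1 = 0"
  unfolding order_poly_def
proof (intro sum.neutral ballI)
  interpret tournament H by fact
  fix \<sigma> :: "nat \<Rightarrow> nat" assume "\<sigma> \<in> {\<sigma>. \<sigma> permutes pverts H}"
  then have \<sigma>: "\<sigma> permutes pverts H" by simp
  with nontrans obtain u v where uv: "(u, v) \<in> parcs H" "\<not> \<sigma> u < \<sigma> v"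
    unfolding transitive_order_def by blast
  then have "\<sigma> u \<noteq> \<sigma> v"
    using pair_no_loops[OF uv(1)] permutes_inj[OF \<sigma>] by (auto simp: inj_eq)
  then have "1 + 1 * order_sign (\<sigma> u) (\<sigma> v) = 0"
    using uv(2) by (simp add: order_sign_def)
  then show "(\<Prod>(u, v)\<in>parcs H. 1 + 1 * order_sign (\<sigma> u) (\<sigma> v)) = 0"
    using uv(1) pair_finite_arcs by (intro prod_zero) force+
qed

lemma exists_balanced_bias:
  assumes "tournament H" "score_excess H > 0" "\<nexists>\<sigma>. transitive_order H \<sigma>"
  shows "\<exists>t\<in>{0<..1}. order_poly H t = fact (card (pverts H))"
proof -
  obtain t\<^sub>0 where t\<^sub>0: "0 < t\<^sub>0" "t\<^sub>0 < 1" "order_poly H t\<^sub>0 > fact (card (pverts H))"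
    using order_poly_exceeds_fact[OF assms(1,2)] by auto
  have "order_poly H 1 \<le> fact (card (pverts H))"
    using order_poly_one_nontransitive[OF assms(1,3)] by simp
  moreover have "continuous_on {t\<^sub>0..1} (order_poly H)"
    unfolding order_poly_def case_prod_beta by (intro continuous_intros)
  ultimately obtain t where "t\<^sub>0 \<le> t" "t \<le> 1" "order_poly H t = fact (card (pverts H))"
    using IVT2'[of "order_poly H" 1 "fact (card (pverts H))" t\<^sub>0] t\<^sub>0 by auto
  then show ?thesis using t\<^sub>0(1) by (intro bexI[of _ t]) auto
qed

section \<open>Biased random hosts\<close>

text \<open>
  Hoeffding's inequality and a union bound. The family \<open>C\<close> may be exponentially large in \<open>n\<close>, which
  is affordable because the deviations at scale \<open>n\<^sup>2\<close> of sums over \<open>n choose 2\<close> coins have probability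
  \<open>exp (- c n\<^sup>2)\<close>.
\<close>
lemma biased_coins_concentrate:
  fixes C :: "('e \<Rightarrow> real) set"
  assumes I: "finite I" "I \<noteq> {}" and p: "0 \<le> p" "p \<le> 1"
    and C: "finite C" "\<And>c e. c \<in> C \<Longrightarrow> e \<in> I \<Longrightarrow> \<bar>c e\<bar> \<le> 1"
    and \<epsilon>: "\<epsilon> \<ge> 0" "real (card C) * (2 * exp (- (\<epsilon>\<^sup>2 / (2 * real (card I))))) < 1"
  shows "\<exists>\<omega>. \<forall>c\<in>C. \<bar>\<Sum>e\<in>I. c e * (of_bool (\<omega> e) - p)\<bar> < \<epsilon>"
proof -
  define M where "M = Pi_pmf I False (\<lambda>_. bernoulli_pmf p)"
  define bad where "bad c = {\<omega>. \<bar>\<Sum>e\<in>I. c e * (of_bool (\<omega> e) - p)\<bar> \<ge> \<epsilon>}" for c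
  have prob_bad: "measure_pmf.prob M (bad c) \<le> 2 * exp (- (\<epsilon>\<^sup>2 / (2 * real (card I))))" if c: "c \<in> C" for c
  proof -
    have mean: "measure_pmf.expectation M (\<lambda>\<omega>. c e * of_bool (\<omega> e)) = c e * p" if "e \<in> I" for e
    proof -
      have "measure_pmf.expectation M (\<lambda>\<omega>. c e * of_bool (\<omega> e))
          = measure_pmf.expectation (map_pmf (\<lambda>\<omega>. \<omega> e) M) (\<lambda>b. c e * of_bool b)"
        by simp
      also have "map_pmf (\<lambda>\<omega>. \<omega> e) M = bernoulli_pmf p"
        unfolding M_def using I that by (simp add: Pi_pmf_component)
      finally show ?thesis using p by simp
    qed
    interpret Hoeffding_ineq M I "\<lambda>e \<omega>. c e * of_bool (\<omega> e)" "\<lambda>_. -1" "\<lambda>_. 1"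
      "\<Sum>e\<in>I. c e * p"
    proof unfold_locales
      have "prob_space.indep_vars M (\<lambda>_. count_space UNIV) (\<lambda>e \<omega>. \<omega> e) I"
        unfolding M_def by (rule indep_vars_Pi_pmf[OF I(1)])
      then show "prob_space.indep_vars M (\<lambda>_. borel) (\<lambda>e \<omega>. c e * of_bool (\<omega> e)) I"
        by (rule prob_space.indep_vars_compose2[OF prob_space_measure_pmf]) simp
      show "AE \<omega> in M. c e * of_bool (\<omega> e) \<in> {-1..1}" if "e \<in> I" for e
        using C(2)[OF c that] by (auto simp: of_bool_def)
      show "(\<Sum>e\<in>I. c e * p) \<equiv> (\<Sum>e\<in>I. measure_pmf.expectation M (\<lambda>\<omega>. c e * of_bool (\<omega> e)))"
        by (rule eq_reflection, rule sum.cong) (simp_all only: mean)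
    qed (use I in auto)
    have "(\<Sum>e\<in>I. (1 - (-1))\<^sup>2) = 4 * real (card I)" by simp
    moreover have "card I > 0" using I by (simp add: card_gt_0_iff)
    ultimately have "measure_pmf.prob M {\<omega>. \<epsilon> \<le> \<bar>(\<Sum>e\<in>I. c e * of_bool (\<omega> e)) - (\<Sum>e\<in>I. c e * p)\<bar>}
        \<le> 2 * exp (- 2 * \<epsilon>\<^sup>2 / (4 * real (card I)))"
      using Hoeffding_ineq_abs_ge[OF \<epsilon>(1)] by simp
    then show ?thesis
      by (simp add: bad_def right_diff_distrib sum_subtractf)
  qed
  have "measure_pmf.prob M (\<Union>c\<in>C. bad c) \<le> (\<Sum>c\<in>C. measure_pmf.prob M (bad c))"
    by (rule measure_pmf.finite_measure_subadditive_finite) (use C in auto)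
  also have "\<dots> \<le> real (card C) * (2 * exp (- (\<epsilon>\<^sup>2 / (2 * real (card I)))))"
    by (rule sum_bounded_above) (rule prob_bad)
  also have "\<dots> < 1" by (rule \<epsilon>(2))
  finally have "(\<Union>c\<in>C. bad c) \<noteq> UNIV" by auto
  then obtain \<omega> where "\<omega> \<notin> (\<Union>c\<in>C. bad c)" by auto
  then have "\<forall>c\<in>C. \<bar>\<Sum>e\<in>I. c e * (of_bool (\<omega> e) - p)\<bar> < \<epsilon>"
    by (auto simp: bad_def not_le)
  then show ?thesis by blast
qed

definition biased_kernel :: "real \<Rightarrow> nat \<Rightarrow> nat \<Rightarrow> real" where
  "biased_kernel p x y = (if x < y then p else if y < x then 1 - p else 0)"

definition adjacency :: "'a pair_pre_digraph \<Rightarrow> 'a \<Rightarrow> 'a \<Rightarrow> real" where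
  "adjacency T x y = of_bool ((x, y) \<in> parcs T)"

text \<open>
  The arc between \<open>i < j\<close> enters a sum over \<open>A \<times> B\<close> positively through \<open>(i, j)\<close> and, being the
  complement of the arc \<open>(j, i)\<close>, negatively through \<open>(j, i)\<close>.
\<close>
definition cut_coefficients :: "nat set \<times> nat set \<Rightarrow> nat \<times> nat \<Rightarrow> real" where
  "cut_coefficients = (\<lambda>(A, B) (i, j). of_bool (i \<in> A \<and> j \<in> B) - of_bool (j \<in> A \<and> i \<in> B))"

lemma parcs_transitive: "parcs (oriented n (\<lambda>_. True)) = vertex_pairs n"
  by (auto simp: oriented_def)

lemma cut_sum_oriented:
  assumes "A \<subseteq> {1..n}" "B \<subseteq> {1..n}"
  shows "(\<Sum>x\<in>A. \<Sum>y\<in>B. adjacency (oriented n \<omega>) x y - biased_kernel p x y)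
    = (\<Sum>e\<in>vertex_pairs n. cut_coefficients (A, B) e * (of_bool (\<omega> e) - p))"
proof -
  define g where "g x y = (of_bool (x \<in> A \<and> y \<in> B) :: real)" for x y
  define d where "d x y = of_bool (\<omega> (x, y)) - p" for x y
  have D: "adjacency (oriented n \<omega>) x y - biased_kernel p x y
      = of_bool ((x, y) \<in> vertex_pairs n) * d x y - of_bool ((y, x) \<in> vertex_pairs n) * d y x"
    if "x \<in> {1..n}" "y \<in> {1..n}" for x y
    using that by (cases x y rule: linorder_cases)
      (auto simp: adjacency_def biased_kernel_def d_def oriented_def vertex_pairs_def)
  note arcs = tournament.sum_arcs[OF tournament_oriented[of n "\<lambda>_. True"], unfolded parcs_transitive pverts_oriented]
    tournament.sum_reversed_arcs[OF tournament_oriented[of n "\<lambda>_. True"], unfolded parcs_transitive pverts_oriented]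
  have "(\<Sum>x\<in>A. \<Sum>y\<in>B. adjacency (oriented n \<omega>) x y - biased_kernel p x y)
      = (\<Sum>x\<in>A. \<Sum>y\<in>B. of_bool ((x, y) \<in> vertex_pairs n) * d x y
          - of_bool ((y, x) \<in> vertex_pairs n) * d y x)"
    using assms by (intro sum.cong refl D) auto
  also have "\<dots> = (\<Sum>x\<in>A. \<Sum>y\<in>{1..n}. of_bool (y \<in> B) * (of_bool ((x, y) \<in> vertex_pairs n) * d x y
          - of_bool ((y, x) \<in> vertex_pairs n) * d y x))"
    using assms by (intro sum.cong refl sum.mono_neutral_cong_left) auto
  also have "\<dots> = (\<Sum>x\<in>{1..n}. \<Sum>y\<in>{1..n}. g x y * (of_bool ((x, y) \<in> vertex_pairs n) * d x y
          - of_bool ((y, x) \<in> vertex_pairs n) * d y x))"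
    using assms by (intro sum.mono_neutral_cong_left) (auto simp: g_def)
  also have "\<dots> = (\<Sum>x\<in>{1..n}. \<Sum>y\<in>{1..n}. of_bool ((x, y) \<in> vertex_pairs n) * (g x y * d x y))
      - (\<Sum>x\<in>{1..n}. \<Sum>y\<in>{1..n}. of_bool ((y, x) \<in> vertex_pairs n) * (g x y * d y x))"
    by (simp only: right_diff_distrib sum_subtractf mult_ac)
  also have "\<dots> = (\<Sum>(x, y)\<in>vertex_pairs n. g x y * d x y) - (\<Sum>(x, y)\<in>vertex_pairs n. g y x * d x y)"
    unfolding arcs ..
  also have "\<dots> = (\<Sum>e\<in>vertex_pairs n. cut_coefficients (A, B) e * (of_bool (\<omega> e) - p))"
    unfolding sum_subtractf[symmetric]
    by (intro sum.cong refl)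
       (auto simp: g_def d_def cut_coefficients_def left_diff_distrib split: prod.split)
  finally show ?thesis .
qed

lemma card_forward_arcs_oriented:
  "real (card (forward_arcs id (oriented n \<omega>))) - p * real (n choose 2)
    = (\<Sum>e\<in>vertex_pairs n. 1 * (of_bool (\<omega> e) - p))"
proof -
  have "forward_arcs id (oriented n \<omega>) = vertex_pairs n \<inter> {e. \<omega> e}"
    by (auto simp: forward_arcs_def oriented_def vertex_pairs_def)
  then show ?thesis
    by (simp add: sum_subtractf card_vertex_pairs mult.commute)
qed

text \<open>
  The \<open>4^n\<close> cuts and the count of forward arcs are all linear statistics of the same coins, so one
  outcome serves them simultaneously.
\<close>
lemma eventually_biased_host:
  assumes p: "0 \<le> p" "p \<le> 1" and \<eta>: "\<eta> > 0"
  shows "eventually (\<lambda>n. \<exists>\<omega>.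
      (\<forall>A B. A \<subseteq> {1..n} \<longrightarrow> B \<subseteq> {1..n} \<longrightarrow>
        \<bar>\<Sum>x\<in>A. \<Sum>y\<in>B. adjacency (oriented n \<omega>) x y - biased_kernel p x y\<bar> \<le> \<eta> * real n ^ 2) \<and>
      \<bar>real (card (forward_arcs id (oriented n \<omega>))) - p * real (n choose 2)\<bar> \<le> \<eta> * real n ^ 2) at_top"
proof -
  have "eventually (\<lambda>n::nat. (4 ^ n + 1) * (2 * exp (- (\<eta>\<^sup>2 * real n ^ 2))) < 1) at_top"
    using \<eta> by real_asymp
  then show ?thesis
    using eventually_ge_at_top[of 2]
  proof eventually_elim
    case (elim n)
    define I where "I = vertex_pairs n"
    define C where "C = insert (\<lambda>_. 1) (cut_coefficients ` (Pow {1..n} \<times> Pow {1..n}))"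
    have I: "finite I" "I \<noteq> {}" "card I = n choose 2"
    proof -
      have "(1, 2) \<in> I" using elim(2) by (simp add: I_def vertex_pairs_def)
      then show "I \<noteq> {}" by auto
    qed (simp_all add: I_def card_vertex_pairs)
    have "card C \<le> Suc (card (cut_coefficients ` (Pow {1..n} \<times> Pow {1..n})))"
      unfolding C_def by (rule card_insert_le_m1) auto
    also have "\<dots> \<le> Suc (card (Pow {1..n} \<times> Pow {1..n}))"
      unfolding Suc_le_mono by (rule card_image_le) simp
    also have "\<dots> = 4 ^ n + 1"
      by (simp add: card_cartesian_product card_Pow flip: power_mult_distrib)
    finally have card_C: "real (card C) \<le> 4 ^ n + 1"
      using of_nat_le_iff[of "card C" "4 ^ n + 1", where 'a = real] by simp
    have pairs: "2 * real (card I) \<le> real n ^ 2"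
    proof -
      have "2 * (n choose 2) \<le> n * (n - 1)" unfolding choose_two by simp
      also have "\<dots> \<le> n * n" by simp
      finally have "real (2 * (n choose 2)) \<le> real (n * n)" by (simp only: of_nat_le_iff)
      then show ?thesis by (simp add: I(3) power2_eq_square)
    qed
    have "(\<eta>\<^sup>2 * real n ^ 2) * (2 * real (card I)) \<le> (\<eta>\<^sup>2 * real n ^ 2) * real n ^ 2"
      by (rule mult_left_mono[OF pairs]) simp
    moreover have "card I > 0" using I(1,2) by (simp add: card_gt_0_iff)
    ultimately have "\<eta>\<^sup>2 * real n ^ 2 \<le> (\<eta> * real n ^ 2)\<^sup>2 / (2 * real (card I))"
      by (simp add: pos_le_divide_eq power_mult_distrib power2_eq_square mult_ac)
    then have "real (card C) * (2 * exp (- ((\<eta> * real n ^ 2)\<^sup>2 / (2 * real (card I)))))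
        \<le> (4 ^ n + 1) * (2 * exp (- (\<eta>\<^sup>2 * real n ^ 2)))"
      by (intro mult_mono card_C) auto
    also have "\<dots> < 1" by (rule elim(1))
    finally obtain \<omega> where \<omega>: "\<And>c. c \<in> C \<Longrightarrow> \<bar>\<Sum>e\<in>I. c e * (of_bool (\<omega> e) - p)\<bar> < \<eta> * real n ^ 2"
      using biased_coins_concentrate[of I p C "\<eta> * real n ^ 2"] I p \<eta>
      by (force simp: C_def cut_coefficients_def split: prod.splits)
    show ?case
    proof (intro exI[of _ \<omega>] conjI allI impI)
      fix A B :: "nat set" assume "A \<subseteq> {1..n}" "B \<subseteq> {1..n}"
      then show "\<bar>\<Sum>x\<in>A. \<Sum>y\<in>B. adjacency (oriented n \<omega>) x y - biased_kernel p x y\<bar> \<le> \<eta> * real n ^ 2"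
        using \<omega>[of "cut_coefficients (A, B)"] cut_sum_oriented[of A n B \<omega> p]
        by (simp add: C_def I_def)
    next
      show "\<bar>real (card (forward_arcs id (oriented n \<omega>))) - p * real (n choose 2)\<bar> \<le> \<eta> * real n ^ 2"
        unfolding card_forward_arcs_oriented using \<omega>[of "\<lambda>_. 1"] by (simp add: C_def I_def)
    qed
  qed
qed

section \<open>Counting maps in biased hosts\<close>

text \<open>A linear form on \<open>[0, 1]^U\<close> is extremal at indicator functions.\<close>
lemma weighted_sum_bound:
  fixes a c :: "'a \<Rightarrow> real"
  assumes U: "finite U" and a: "\<And>x. x \<in> U \<Longrightarrow> 0 \<le> a x \<and> a x \<le> 1"
    and M: "\<And>A. A \<subseteq> U \<Longrightarrow> \<bar>sum c A\<bar> \<le> M"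
  shows "\<bar>\<Sum>x\<in>U. a x * c x\<bar> \<le> M"
proof -
  have upper: "(\<Sum>x\<in>U. a x * d x) \<le> sum d {x \<in> U. d x > 0}" for d :: "'a \<Rightarrow> real"
  proof -
    have "(\<Sum>x\<in>U. a x * d x) \<le> (\<Sum>x\<in>U. if d x > 0 then d x else 0)"
    proof (rule sum_mono)
      fix x assume "x \<in> U"
      then show "a x * d x \<le> (if d x > 0 then d x else 0)"
        using a[of x] mult_right_mono[of "a x" 1 "d x"] by (auto simp: mult_nonneg_nonpos)
    qed
    then show ?thesis using U by (simp add: sum.inter_filter)
  qed
  have "(\<Sum>x\<in>U. a x * c x) \<le> M"
    using upper[of c] M[of "{x \<in> U. c x > 0}"] by force
  moreover have "- (\<Sum>x\<in>U. a x * c x) \<le> M"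
    using upper[of "\<lambda>x. - c x"] M[of "{x \<in> U. c x < 0}"] by (force simp: sum_negf)
  ultimately show ?thesis by linarith
qed

lemma bilinear_form_bound:
  fixes a b :: "'a \<Rightarrow> real"
  assumes U: "finite U"
    and a: "\<And>x. x \<in> U \<Longrightarrow> 0 \<le> a x \<and> a x \<le> 1" and b: "\<And>x. x \<in> U \<Longrightarrow> 0 \<le> b x \<and> b x \<le> 1"
    and M: "\<And>A B. A \<subseteq> U \<Longrightarrow> B \<subseteq> U \<Longrightarrow> \<bar>\<Sum>x\<in>A. \<Sum>y\<in>B. D x y\<bar> \<le> M"
  shows "\<bar>\<Sum>x\<in>U. \<Sum>y\<in>U. a x * b y * D x y\<bar> \<le> M"
proof -
  have "\<bar>\<Sum>x\<in>U. a x * (\<Sum>y\<in>U. b y * D x y)\<bar> \<le> M"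
  proof (rule weighted_sum_bound[OF U a])
    fix A assume A: "A \<subseteq> U"
    have "\<bar>\<Sum>y\<in>U. b y * (\<Sum>x\<in>A. D x y)\<bar> \<le> M"
    proof (rule weighted_sum_bound[OF U b])
      fix B assume "B \<subseteq> U"
      then show "\<bar>\<Sum>y\<in>B. \<Sum>x\<in>A. D x y\<bar> \<le> M"
        by (subst sum.swap) (rule M[OF A])
    qed
    then show "\<bar>\<Sum>x\<in>A. \<Sum>y\<in>U. b y * D x y\<bar> \<le> M"
      by (subst sum.swap) (simp add: sum_distrib_left)
  qed
  then show ?thesis by (simp add: sum_distrib_left mult.assoc)
qed

lemma sum_PiE_insert:
  fixes F :: "('a \<Rightarrow> 'b) \<Rightarrow> real"
  assumes "a \<notin> V"
  shows "(\<Sum>\<phi>\<in>insert a V \<rightarrow>\<^sub>E U. F \<phi>) = (\<Sum>\<psi>\<in>V \<rightarrow>\<^sub>E U. \<Sum>x\<in>U. F (\<psi>(a := x)))"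
proof -
  have "(\<Sum>\<phi>\<in>insert a V \<rightarrow>\<^sub>E U. F \<phi>) = (\<Sum>(x, \<psi>)\<in>U \<times> (V \<rightarrow>\<^sub>E U). F (\<psi>(a := x)))"
    unfolding PiE_insert_eq using inj_combinator[OF assms, of "\<lambda>_. U"]
    by (subst sum.reindex) (auto intro!: sum.cong)
  also have "\<dots> = (\<Sum>\<psi>\<in>V \<rightarrow>\<^sub>E U. \<Sum>x\<in>U. F (\<psi>(a := x)))"
    by (subst sum.swap) (simp add: sum.cartesian_product)
  finally show ?thesis .
qed

text \<open>
  Fix the images of all vertices other than \<open>u\<close> and \<open>v\<close>. As no factor of the product involves both
  \<open>u\<close> and \<open>v\<close>, it splits into a function of \<open>\<phi> u\<close> times a function of \<open>\<phi> v\<close>, and the remaining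
  double sum is a bilinear form controlled by the cuts.
\<close>
lemma one_edge_discrepancy:
  fixes D :: "'b \<Rightarrow> 'b \<Rightarrow> real" and K :: "'a \<times> 'a \<Rightarrow> 'b \<Rightarrow> 'b \<Rightarrow> real"
  assumes V: "finite V" "u \<in> V" "v \<in> V" "u \<noteq> v" and U: "finite U"
    and E: "finite E" "\<And>e. e \<in> E \<Longrightarrow> fst e \<in> V \<and> snd e \<in> V \<and> {fst e, snd e} \<noteq> {u, v} \<and> fst e \<noteq> snd e"
    and K: "\<And>e x y. 0 \<le> K e x y \<and> K e x y \<le> 1"
    and M: "\<And>A B. A \<subseteq> U \<Longrightarrow> B \<subseteq> U \<Longrightarrow> \<bar>\<Sum>x\<in>A. \<Sum>y\<in>B. D x y\<bar> \<le> M"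
  shows "\<bar>\<Sum>\<phi>\<in>V \<rightarrow>\<^sub>E U. (\<Prod>e\<in>E. K e (\<phi> (fst e)) (\<phi> (snd e))) * D (\<phi> u) (\<phi> v)\<bar>
    \<le> M * real (card U) ^ (card V - 2)"
proof -
  define V' where "V' = V - {u, v}"
  have V': "V = insert u (insert v V')" "u \<notin> insert v V'" "v \<notin> V'" "finite V'" "card V' = card V - 2"
    using V by (auto simp: V'_def card_Diff_subset)
  define P where "P \<phi> = (\<Prod>e\<in>E. K e (\<phi> (fst e)) (\<phi> (snd e)))" for \<phi>
  have bound: "\<bar>\<Sum>x\<in>U. \<Sum>y\<in>U. P (\<psi>(v := y, u := x)) * D x y\<bar> \<le> M" for \<psi>
  proof -
    define a where "a x = (\<Prod>e\<in>{e \<in> E. v \<notin> {fst e, snd e}}. K e ((\<psi>(u := x)) (fst e)) ((\<psi>(u := x)) (snd e)))" for x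
    define b where "b y = (\<Prod>e\<in>{e \<in> E. v \<in> {fst e, snd e}}. K e ((\<psi>(v := y)) (fst e)) ((\<psi>(v := y)) (snd e)))" for y
    have split: "P (\<psi>(v := y, u := x)) = a x * b y" for x y
    proof -
      have "P (\<psi>(v := y, u := x))
          = (\<Prod>e\<in>{e \<in> E. v \<notin> {fst e, snd e}}. K e ((\<psi>(v := y, u := x)) (fst e)) ((\<psi>(v := y, u := x)) (snd e)))
          * (\<Prod>e\<in>{e \<in> E. v \<in> {fst e, snd e}}. K e ((\<psi>(v := y, u := x)) (fst e)) ((\<psi>(v := y, u := x)) (snd e)))"
        unfolding P_def using E(1) by (subst prod.union_disjoint[symmetric]) (auto intro!: prod.cong)
      also have "(\<Prod>e\<in>{e \<in> E. v \<notin> {fst e, snd e}}. K e ((\<psi>(v := y, u := x)) (fst e)) ((\<psi>(v := y, u := x)) (snd e))) = a x"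
        unfolding a_def by (intro prod.cong refl) auto
      also have "(\<Prod>e\<in>{e \<in> E. v \<in> {fst e, snd e}}. K e ((\<psi>(v := y, u := x)) (fst e)) ((\<psi>(v := y, u := x)) (snd e))) = b y"
        unfolding b_def
      proof (intro prod.cong refl)
        fix e assume "e \<in> {e \<in> E. v \<in> {fst e, snd e}}"
        then have "fst e \<noteq> u" "snd e \<noteq> u" using E(2)[of e] V(4) by auto
        then show "K e ((\<psi>(v := y, u := x)) (fst e)) ((\<psi>(v := y, u := x)) (snd e))
            = K e ((\<psi>(v := y)) (fst e)) ((\<psi>(v := y)) (snd e))" by simp
      qed
      finally show ?thesis .
    qed
    show ?thesis
      unfolding split by (rule bilinear_form_bound[OF U _ _ M])
        (auto simp: a_def b_def K intro!: prod_nonneg prod_le_1)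
  qed
  have "(\<Sum>\<phi>\<in>V \<rightarrow>\<^sub>E U. P \<phi> * D (\<phi> u) (\<phi> v))
      = (\<Sum>\<psi>\<in>V' \<rightarrow>\<^sub>E U. \<Sum>y\<in>U. \<Sum>x\<in>U. P (\<psi>(v := y, u := x)) * D x y)"
    unfolding V'(1) using V'(2,3) V(4) V(4)[symmetric] by (simp add: sum_PiE_insert)
  also have "\<dots> = (\<Sum>\<psi>\<in>V' \<rightarrow>\<^sub>E U. \<Sum>x\<in>U. \<Sum>y\<in>U. P (\<psi>(v := y, u := x)) * D x y)"
    by (intro sum.cong refl sum.swap)
  also have "\<bar>\<dots>\<bar> \<le> (\<Sum>\<psi>\<in>V' \<rightarrow>\<^sub>E U. \<bar>\<Sum>x\<in>U. \<Sum>y\<in>U. P (\<psi>(v := y, u := x)) * D x y\<bar>)"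
    by (rule sum_abs)
  also have "\<dots> \<le> real (card (V' \<rightarrow>\<^sub>E U)) * M"
    by (rule sum_bounded_above) (rule bound)
  also have "\<dots> = M * real (card U) ^ (card V - 2)"
    using V'(4,5) by (simp add: card_PiE)
  finally show ?thesis unfolding P_def .
qed

text \<open>
  Replace \<open>W\<close> by \<open>S\<close> one arc at a time. The two factors that differ sit on a single arc, and in a
  tournament no other arc joins its end points.
\<close>
lemma (in tournament) counting_lemma:
  fixes S W :: "'b \<Rightarrow> 'b \<Rightarrow> real"
  assumes U: "finite U"
    and S: "\<And>x y. 0 \<le> S x y \<and> S x y \<le> 1" and W: "\<And>x y. 0 \<le> W x y \<and> W x y \<le> 1"
    and M: "\<And>A B. A \<subseteq> U \<Longrightarrow> B \<subseteq> U \<Longrightarrow> \<bar>\<Sum>x\<in>A. \<Sum>y\<in>B. S x y - W x y\<bar> \<le> M"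
  shows "\<bar>(\<Sum>\<phi>\<in>pverts T \<rightarrow>\<^sub>E U. \<Prod>(u, v)\<in>parcs T. S (\<phi> u) (\<phi> v))
      - (\<Sum>\<phi>\<in>pverts T \<rightarrow>\<^sub>E U. \<Prod>(u, v)\<in>parcs T. W (\<phi> u) (\<phi> v))\<bar>
    \<le> real (card (parcs T)) * (M * real (card U) ^ (card (pverts T) - 2))"
proof -
  define N where "N F = (\<Sum>\<phi>\<in>pverts T \<rightarrow>\<^sub>E U. \<Prod>e\<in>parcs T.
      (if e \<in> F then S else W) (\<phi> (fst e)) (\<phi> (snd e)))" for F
  have "\<bar>N F - N {}\<bar> \<le> real (card F) * (M * real (card U) ^ (card (pverts T) - 2))"
    if "F \<subseteq> parcs T" for F
    using finite_subset[OF that pair_finite_arcs] that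
  proof (induction F rule: finite_induct)
    case empty
    show ?case by simp
  next
    case (insert e F)
    define R where "R \<phi> = (\<Prod>e'\<in>parcs T - {e}.
        (if e' \<in> F then S else W) (\<phi> (fst e')) (\<phi> (snd e')))" for \<phi>
    have e: "e \<in> parcs T" using insert.prems by simp
    have with_e: "N (insert e F) = (\<Sum>\<phi>\<in>pverts T \<rightarrow>\<^sub>E U. R \<phi> * S (\<phi> (fst e)) (\<phi> (snd e)))"
      unfolding N_def R_def prod.remove[OF pair_finite_arcs e]
      by (intro sum.cong refl) (auto intro!: prod.cong)
    have without_e: "N F = (\<Sum>\<phi>\<in>pverts T \<rightarrow>\<^sub>E U. R \<phi> * W (\<phi> (fst e)) (\<phi> (snd e)))"
      unfolding N_def R_def prod.remove[OF pair_finite_arcs e]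
      using insert.hyps(2) by (intro sum.cong refl) auto
    have "N (insert e F) - N F
        = (\<Sum>\<phi>\<in>pverts T \<rightarrow>\<^sub>E U. R \<phi> * (S (\<phi> (fst e)) (\<phi> (snd e)) - W (\<phi> (fst e)) (\<phi> (snd e))))"
      unfolding with_e without_e by (simp add: right_diff_distrib sum_subtractf)
    also have "\<bar>\<dots>\<bar> \<le> M * real (card U) ^ (card (pverts T) - 2)"
      unfolding R_def
    proof (rule one_edge_discrepancy[OF pair_finite_verts _ _ _ U, where D = "\<lambda>x y. S x y - W x y"
          and K = "\<lambda>e'. if e' \<in> F then S else W"])
      show "fst e \<in> pverts T" "snd e \<in> pverts T" "fst e \<noteq> snd e"
        using e arc_fst_in_verts arc_snd_in_verts pair_no_loops by auto
      show "finite (parcs T - {e})" using pair_finite_arcs by simp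
      fix e' assume e': "e' \<in> parcs T - {e}"
      then have "fst e' \<in> pverts T" "snd e' \<in> pverts T" "fst e' \<noteq> snd e'"
        using arc_fst_in_verts arc_snd_in_verts pair_no_loops by auto
      moreover have "{fst e', snd e'} \<noteq> {fst e, snd e}"
        using e e' arc_asym[of "fst e" "snd e"] by (cases e; cases e') (auto simp: doubleton_eq_iff)
      ultimately show "fst e' \<in> pverts T \<and> snd e' \<in> pverts T \<and> {fst e', snd e'} \<noteq> {fst e, snd e}
          \<and> fst e' \<noteq> snd e'" by blast
    qed (use S W M in auto)
    finally have "\<bar>N (insert e F) - N F\<bar> \<le> M * real (card U) ^ (card (pverts T) - 2)" .
    moreover have "\<bar>N F - N {}\<bar> \<le> real (card F) * (M * real (card U) ^ (card (pverts T) - 2))"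
      using insert by simp
    ultimately show ?case using insert.hyps by (simp add: distrib_right)
  qed
  from this[of "parcs T"] show ?thesis
    by (simp add: N_def case_prod_beta cong: prod.cong)
qed

text \<open>
  Preserving arcs suffices for an embedding of tournaments: a non-arc between distinct vertices is
  the reversal of an arc.
\<close>
lemma num_embeddings_eq_sum:
  fixes H :: "'a pair_pre_digraph" and T :: "'b pair_pre_digraph"
  assumes H: "tournament H" and T: "tournament T" and U: "U \<subseteq> pverts T"
  shows "real (num_embeddings T H U)
    = (\<Sum>\<phi>\<in>pverts H \<rightarrow>\<^sub>E U. \<Prod>(u, v)\<in>parcs H. adjacency T (\<phi> u) (\<phi> v))"
proof -
  interpret H: tournament H by fact
  interpret T: tournament T by fact
  have fin: "finite (pverts H \<rightarrow>\<^sub>E U)"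
    using H.pair_finite_verts finite_subset[OF U T.pair_finite_verts] by (intro finite_PiE) auto
  have iff: "(\<forall>u\<in>pverts H. \<forall>v\<in>pverts H. (u, v) \<in> parcs H \<longleftrightarrow> (\<phi> u, \<phi> v) \<in> parcs T \<inter> U \<times> U)
      \<longleftrightarrow> (\<forall>(u, v)\<in>parcs H. (\<phi> u, \<phi> v) \<in> parcs T)" (is "?L \<longleftrightarrow> ?R")
    if \<phi>: "\<phi> \<in> pverts H \<rightarrow>\<^sub>E U" for \<phi>
  proof
    assume ?L
    then show ?R using H.in_arcsD1 H.in_arcsD2 by blast
  next
    assume R: ?R
    show ?L
    proof (intro ballI)
      fix u v assume uv: "u \<in> pverts H" "v \<in> pverts H"
      have mem: "\<phi> u \<in> U" "\<phi> v \<in> U" using uv \<phi> by auto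
      show "(u, v) \<in> parcs H \<longleftrightarrow> (\<phi> u, \<phi> v) \<in> parcs T \<inter> U \<times> U"
      proof
        assume "(u, v) \<in> parcs H"
        then show "(\<phi> u, \<phi> v) \<in> parcs T \<inter> U \<times> U" using R mem by auto
      next
        assume arc: "(\<phi> u, \<phi> v) \<in> parcs T \<inter> U \<times> U"
        then have "u \<noteq> v" using T.pair_no_loops by force
        moreover have "(v, u) \<notin> parcs H" using R arc T.arc_asym by blast
        ultimately show "(u, v) \<in> parcs H" using H.exactly_one_arc[OF uv] by simp
      qed
    qed
  qed
  have "labelled_embeddings H (induced T U)
      = (pverts H \<rightarrow>\<^sub>E U) \<inter> {\<phi>. \<forall>(u, v)\<in>parcs H. (\<phi> u, \<phi> v) \<in> parcs T}"
  proof -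
    have "labelled_embeddings H (induced T U)
        = {\<phi> \<in> pverts H \<rightarrow>\<^sub>E U. \<forall>u\<in>pverts H. \<forall>v\<in>pverts H.
            (u, v) \<in> parcs H \<longleftrightarrow> (\<phi> u, \<phi> v) \<in> parcs T \<inter> U \<times> U}"
      by (simp add: labelled_embeddings_def induced_def)
    also have "\<dots> = {\<phi> \<in> pverts H \<rightarrow>\<^sub>E U. \<forall>(u, v)\<in>parcs H. (\<phi> u, \<phi> v) \<in> parcs T}"
      using iff by (intro Collect_cong conj_cong refl)
    finally show ?thesis by blast
  qed
  then have "real (num_embeddings T H U)
      = (\<Sum>\<phi>\<in>pverts H \<rightarrow>\<^sub>E U. of_bool (\<forall>(u, v)\<in>parcs H. (\<phi> u, \<phi> v) \<in> parcs T))"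
    using fin by (simp add: num_embeddings_def)
  also have "\<dots> = (\<Sum>\<phi>\<in>pverts H \<rightarrow>\<^sub>E U. \<Prod>(u, v)\<in>parcs H. adjacency T (\<phi> u) (\<phi> v))"
  proof (intro sum.cong refl)
    fix \<phi>
    have "(\<Prod>e\<in>E. of_bool (Q e)) = (of_bool (\<forall>e\<in>E. Q e) :: real)" if "finite E"
      for E and Q :: "'a \<times> 'a \<Rightarrow> bool"
      using that by (induction E rule: finite_induct) auto
    from this[OF H.pair_finite_arcs] show "of_bool (\<forall>(u, v)\<in>parcs H. (\<phi> u, \<phi> v) \<in> parcs T)
        = (\<Prod>(u, v)\<in>parcs H. adjacency T (\<phi> u) (\<phi> v))"
      by (simp add: adjacency_def case_prod_beta)
  qed
  finally show ?thesis .
qed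

lemma biased_kernel_order_sign:
  "x \<noteq> y \<Longrightarrow> biased_kernel ((1 + t) / 2) x y = (1 + t * order_sign x y) / 2"
  by (auto simp: biased_kernel_def order_sign_def field_simps)

text \<open>
  The kernel sees only the order of its arguments, so the increasing bijection from \<open>pverts H\<close> to \<open>S\<close>
  turns the bijections onto \<open>S\<close> into permutations of \<open>pverts H\<close>.
\<close>
lemma sum_bijections_biased_kernel:
  assumes H: "tournament H" and S: "finite S" "card S = card (pverts H)"
  shows "(\<Sum>\<phi> | \<phi> \<in> pverts H \<rightarrow>\<^sub>E S \<and> bij_betw \<phi> (pverts H) S.
      \<Prod>(u, v)\<in>parcs H. biased_kernel ((1 + t) / 2) (\<phi> u) (\<phi> v))
    = order_poly H t / 2 ^ card (parcs H)"
proof -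
  interpret tournament H by fact
  define V where "V = pverts H"
  have V: "finite V" unfolding V_def by (rule pair_finite_verts)
  obtain e where e: "bij_betw e V S" "strict_mono_on V e"
  proof -
    obtain f g where f: "bij_betw f {..<card V} V" "strict_mono_on {..<card V} f"
      and g: "bij_betw g {..<card S} S" "strict_mono_on {..<card S} g"
      using ex_bij_betw_strict_mono_card[OF V] ex_bij_betw_strict_mono_card[OF S(1)] by metis
    define f' where "f' = inv_into {..<card V} f"
    have f': "bij_betw f' V {..<card V}" unfolding f'_def by (rule bij_betw_inv_into[OF f(1)])
    have "strict_mono_on V f'"
    proof (rule strict_mono_onI)
      fix x y assume xy: "x \<in> V" "y \<in> V" "x < y"
      have "f (f' x) = x" "f (f' y) = y" "f' x \<in> {..<card V}" "f' y \<in> {..<card V}"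
        using xy f' f(1) by (auto simp: f'_def bij_betw_def f_inv_into_f dest: bij_betwE)
      then show "f' x < f' y"
        using xy(3) strict_mono_on_less[OF f(2)] by metis
    qed
    have "strict_mono_on V (g \<circ> f')"
    proof (intro strict_mono_onI)
      fix x y assume "x \<in> V" "y \<in> V" "x < y"
      moreover from this have "f' x \<in> {..<card S}" "f' y \<in> {..<card S}"
        using bij_betwE[OF f'] S(2) by (auto simp: V_def)
      ultimately show "(g \<circ> f') x < (g \<circ> f') y"
        using strict_mono_onD[OF g(2)] strict_mono_onD[OF \<open>strict_mono_on V f'\<close>] by simp
    qed
    moreover have "bij_betw (g \<circ> f') V S"
      using bij_betw_trans[OF f'] g(1) S(2) by (simp add: V_def)
    ultimately show ?thesis using that by blast
  qed
  have sign: "order_sign (e x) (e y) = order_sign x y" if "x \<in> V" "y \<in> V" for x y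
    using strict_mono_on_less[OF e(2)] that by (auto simp: order_sign_def)
  define e' where "e' = inv_into V e"
  have e': "\<And>x. x \<in> V \<Longrightarrow> e' (e x) = x" "\<And>y. y \<in> S \<Longrightarrow> e (e' y) = y" "\<And>y. y \<in> S \<Longrightarrow> e' y \<in> V"
    using e(1) by (auto simp: e'_def bij_betw_def inv_into_f_f f_inv_into_f inv_into_into)
  have "(\<Sum>\<phi> | \<phi> \<in> V \<rightarrow>\<^sub>E S \<and> bij_betw \<phi> V S.
        \<Prod>(u, v)\<in>parcs H. biased_kernel ((1 + t) / 2) (\<phi> u) (\<phi> v))
      = (\<Sum>\<sigma> | \<sigma> permutes V. \<Prod>(u, v)\<in>parcs H. (1 + t * order_sign (\<sigma> u) (\<sigma> v)) / 2)"
  proof (rule sum.reindex_bij_witness[where i = "\<lambda>\<sigma>. restrict (e \<circ> \<sigma>) V"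
        and j = "\<lambda>\<phi> x. if x \<in> V then e' (\<phi> x) else x"])
    fix \<phi> assume \<phi>: "\<phi> \<in> {\<phi>. \<phi> \<in> V \<rightarrow>\<^sub>E S \<and> bij_betw \<phi> V S}"
    show "restrict (e \<circ> (\<lambda>x. if x \<in> V then e' (\<phi> x) else x)) V = \<phi>"
      using \<phi> e'(2) by (auto simp: fun_eq_iff PiE_def extensional_def)
    have "bij_betw (e' \<circ> \<phi>) V V"
      using \<phi> bij_betw_inv_into[OF e(1)] by (auto simp: e'_def intro: bij_betw_trans)
    then have "bij_betw (\<lambda>x. if x \<in> V then e' (\<phi> x) else x) V V"
      by (rule bij_betw_cong[THEN iffD1, rotated]) simp
    then show perm: "(\<lambda>x. if x \<in> V then e' (\<phi> x) else x) \<in> {\<sigma>. \<sigma> permutes V}"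
      by (auto intro: bij_imp_permutes)
    show "(\<Prod>(u, v)\<in>parcs H. (1 + t * order_sign (if u \<in> V then e' (\<phi> u) else u)
          (if v \<in> V then e' (\<phi> v) else v)) / 2)
        = (\<Prod>(u, v)\<in>parcs H. biased_kernel ((1 + t) / 2) (\<phi> u) (\<phi> v))"
    proof (intro prod.cong refl, clarify)
      fix u v assume uv: "(u, v) \<in> parcs H"
      then have mem: "u \<in> V" "v \<in> V" "u \<noteq> v"
        using in_arcsD1 in_arcsD2 pair_no_loops[of "(u, v)"] by (auto simp: V_def)
      then have img: "\<phi> u \<in> S" "\<phi> v \<in> S" "\<phi> u \<noteq> \<phi> v"
        using \<phi> by (auto simp: bij_betw_def inj_on_def)
      then have "order_sign (e' (\<phi> u)) (e' (\<phi> v)) = order_sign (\<phi> u) (\<phi> v)"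
        using sign[of "e' (\<phi> u)" "e' (\<phi> v)"] e' by simp
      then show "(1 + t * order_sign (if u \<in> V then e' (\<phi> u) else u)
          (if v \<in> V then e' (\<phi> v) else v)) / 2 = biased_kernel ((1 + t) / 2) (\<phi> u) (\<phi> v)"
        using mem img by (simp add: biased_kernel_order_sign)
    qed
  next
    fix \<sigma> assume "\<sigma> \<in> {\<sigma>. \<sigma> permutes V}"
    then have \<sigma>: "\<sigma> permutes V" by simp
    show "(\<lambda>x. if x \<in> V then e' (restrict (e \<circ> \<sigma>) V x) else x) = \<sigma>"
      using e'(1) permutes_in_image[OF \<sigma>] permutes_not_in[OF \<sigma>] by (auto simp: fun_eq_iff)
    have "bij_betw (e \<circ> \<sigma>) V S"
      by (rule bij_betw_trans[OF permutes_imp_bij[OF \<sigma>] e(1)])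
    then have "bij_betw (restrict (e \<circ> \<sigma>) V) V S" by simp
    then show "restrict (e \<circ> \<sigma>) V \<in> {\<phi>. \<phi> \<in> V \<rightarrow>\<^sub>E S \<and> bij_betw \<phi> V S}"
      by (auto dest: bij_betwE)
  qed
  also have "\<dots> = order_poly H t / 2 ^ card (parcs H)"
    by (simp add: order_poly_def V_def case_prod_beta prod_dividef sum_divide_distrib)
  finally show ?thesis unfolding V_def .
qed

text \<open>
  Maps that are not injective contribute nothing, as the kernel vanishes on the diagonal. The others
  are grouped by their image, and all images of the right size contribute equally.
\<close>
lemma sum_maps_biased_kernel:
  assumes H: "tournament H" and U: "finite U"
  shows "(\<Sum>\<phi>\<in>pverts H \<rightarrow>\<^sub>E U. \<Prod>(u, v)\<in>parcs H. biased_kernel ((1 + t) / 2) (\<phi> u) (\<phi> v))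
    = real (card U choose card (pverts H)) * (order_poly H t / 2 ^ card (parcs H))"
proof -
  interpret tournament H by fact
  define V where "V = pverts H"
  define w where "w \<phi> = (\<Prod>(u, v)\<in>parcs H. biased_kernel ((1 + t) / 2) (\<phi> u) (\<phi> v))" for \<phi>
  define Inj where "Inj = {\<phi> \<in> V \<rightarrow>\<^sub>E U. inj_on \<phi> V}"
  have V: "finite V" unfolding V_def by (rule pair_finite_verts)
  have fin: "finite (V \<rightarrow>\<^sub>E U)" using V U by (intro finite_PiE) auto
  have "w \<phi> = 0" if noninj: "\<not> inj_on \<phi> V" for \<phi>
  proof -
    obtain u v where uv: "u \<in> V" "v \<in> V" "u \<noteq> v" "\<phi> u = \<phi> v"
      using noninj by (auto simp: inj_on_def)
    then have "(u, v) \<in> parcs H \<or> (v, u) \<in> parcs H"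
      using exactly_one_arc[of u v] by (auto simp: V_def)
    moreover have "biased_kernel ((1 + t) / 2) (\<phi> u) (\<phi> v) = 0"
      "biased_kernel ((1 + t) / 2) (\<phi> v) (\<phi> u) = 0"
      using uv(4) by (simp_all add: biased_kernel_def)
    ultimately show ?thesis
      unfolding w_def by (intro prod_zero pair_finite_arcs) force
  qed
  then have "(\<Sum>\<phi>\<in>V \<rightarrow>\<^sub>E U. w \<phi>) = (\<Sum>\<phi>\<in>Inj. w \<phi>)"
    using fin by (intro sum.mono_neutral_right) (auto simp: Inj_def)
  also have "\<dots> = (\<Sum>S\<in>{S. S \<subseteq> U \<and> card S = card V}. \<Sum>\<phi>\<in>{\<phi> \<in> Inj. \<phi> ` V = S}. w \<phi>)"
  proof (rule sum.group[symmetric])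
    show "finite Inj" using fin by (simp add: Inj_def)
    show "finite {S. S \<subseteq> U \<and> card S = card V}" using U by simp
    show "(\<lambda>\<phi>. \<phi> ` V) ` Inj \<subseteq> {S. S \<subseteq> U \<and> card S = card V}"
      by (auto simp: Inj_def card_image)
  qed
  also have "\<dots> = (\<Sum>S\<in>{S. S \<subseteq> U \<and> card S = card V}. order_poly H t / 2 ^ card (parcs H))"
  proof (intro sum.cong refl)
    fix S assume "S \<in> {S. S \<subseteq> U \<and> card S = card V}"
    then have S: "S \<subseteq> U" "finite S" "card S = card (pverts H)"
      using finite_subset[OF _ U] by (auto simp: V_def)
    have "{\<phi> \<in> Inj. \<phi> ` V = S} = {\<phi>. \<phi> \<in> V \<rightarrow>\<^sub>E S \<and> bij_betw \<phi> V S}"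
      using S(1) by (auto simp: Inj_def bij_betw_def PiE_def Pi_def)
    then show "(\<Sum>\<phi>\<in>{\<phi> \<in> Inj. \<phi> ` V = S}. w \<phi>) = order_poly H t / 2 ^ card (parcs H)"
      using sum_bijections_biased_kernel[OF H S(2,3)] by (simp add: w_def V_def)
  qed
  also have "\<dots> = real (card U choose card V) * (order_poly H t / 2 ^ card (parcs H))"
    using n_subsets[OF U] by simp
  finally show ?thesis by (simp add: w_def V_def)
qed

section \<open>Tournaments that are not locally forcing\<close>

text \<open>Non-injective maps are of lower order: \<open>fact h * (u choose h)\<close> counts the injective ones among all \<open>u ^ h\<close>.\<close>
lemma power_minus_falling_factorial:
  assumes "u \<le> (n::nat)"
  shows "real u ^ h - fact h * real (u choose h) \<le> real h ^ 2 * real n ^ (h - 1)"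
proof (induction h)
  case 0
  show ?case by simp
next
  case (Suc h)
  define P where "P = fact h * real (u choose h)"
  have P: "P \<le> real u ^ h"
    using binomial_fact_pow[of u h] unfolding P_def
    by (metis mult.commute of_nat_fact of_nat_le_iff of_nat_mult of_nat_power)
  have rec: "fact (Suc h) * real (u choose Suc h) = P * (real u - real h)"
  proof (cases "h \<le> u")
    case True
    have "Suc h * (u choose Suc h) = (u - h) * (u choose h)"
      using binomial_absorb_comp[of u h] binomial_absorption[of h u] True
      by (metis Suc_times_binomial_add binomial_symmetric diff_mult_distrib mult.commute add_diff_inverse_nat not_less)
    then have "real (Suc h) * real (u choose Suc h) = (real u - real h) * real (u choose h)"
      using True by (metis of_nat_diff of_nat_mult)
    then have "fact h * (real (Suc h) * real (u choose Suc h)) = P * (real u - real h)"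
      unfolding P_def by (simp only: mult_ac)
    then show ?thesis by (simp only: fact_Suc of_nat_mult mult_ac)
  next
    case False
    then show ?thesis by (simp add: P_def binomial_eq_0)
  qed
  have "real u ^ Suc h - fact (Suc h) * real (u choose Suc h)
      = real u * (real u ^ h - P) + real h * P"
    unfolding rec by (simp add: algebra_simps)
  also have "\<dots> \<le> real h ^ 2 * real n ^ h + real h * real n ^ h"
  proof (rule add_mono)
    have "real u ^ h - P \<le> real h ^ 2 * real n ^ (h - 1)" using Suc.IH unfolding P_def .
    then have "real u * (real u ^ h - P) \<le> real n * (real h ^ 2 * real n ^ (h - 1))"
      by (intro mult_mono) (use P assms in auto)
    also have "\<dots> = real h ^ 2 * real n ^ h"
      by (cases "h = 0") (simp_all add: power_eq_if[of _ h])
    finally show "real u * (real u ^ h - P) \<le> real h ^ 2 * real n ^ h" .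
    have "P \<le> real n ^ h" using P power_mono[of "real u" "real n" h] assms by linarith
    then show "real h * P \<le> real h * real n ^ h" by (intro mult_left_mono) auto
  qed
  also have "\<dots> \<le> real (Suc h) ^ 2 * real n ^ (Suc h - 1)"
    by (simp add: power2_eq_square algebra_simps)
  finally show ?case .
qed

lemma (in tournament) card_arcs_choose: "card (parcs T) = card (pverts T) choose 2"
proof -
  have "2 * real (card (parcs T)) = real (card (pverts T) * (card (pverts T) - 1))"
    unfolding card_arcs by (cases "card (pverts T)") (auto simp: algebra_simps)
  then have "2 * card (parcs T) = card (pverts T) * (card (pverts T) - 1)"
    by (metis of_nat_eq_iff of_nat_mult of_nat_numeral)
  then show ?thesis unfolding choose_two by simp
qed

text \<open>
  When \<open>order_poly H t = h!\<close>, the kernel count in \<open>U\<close> is \<open>h! * (card U choose h) / 2^(h choose 2)\<close>, the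
  same as in an unbiased random host. The two error terms come from the cut norm and from the
  non-injective maps.
\<close>
lemma biased_host_counts:
  assumes H: "tournament H" and h: "2 \<le> card (pverts H)"
    and t: "0 \<le> t" "t \<le> 1" "order_poly H t = fact (card (pverts H))" and \<eta>: "\<eta> \<ge> 0"
    and cut: "\<And>A B. A \<subseteq> {1..n} \<Longrightarrow> B \<subseteq> {1..n} \<Longrightarrow>
      \<bar>\<Sum>x\<in>A. \<Sum>y\<in>B. adjacency (oriented n \<omega>) x y - biased_kernel ((1 + t) / 2) x y\<bar> \<le> \<eta> * real n ^ 2"
    and U: "U \<subseteq> {1..n}"
  shows "\<bar>real (num_embeddings (oriented n \<omega>) H U)
      - real (card U) ^ card (pverts H) / 2 ^ (card (pverts H) choose 2)\<bar>
    \<le> real (card (parcs H)) * \<eta> * real n ^ card (pverts H)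
      + real (card (pverts H)) ^ 2 * real n ^ (card (pverts H) - 1)"
proof -
  interpret tournament H by fact
  define h where "h = card (pverts H)"
  define m where "m = card (parcs H)"
  define main where "main = fact h * real (card U choose h)"
  have finU: "finite U" using U finite_subset by blast
  have cardU: "card U \<le> n" using card_mono[OF _ U] by simp
  have m: "m = h choose 2" unfolding m_def h_def by (rule card_arcs_choose)
  have "\<bar>real (num_embeddings (oriented n \<omega>) H U)
      - (\<Sum>\<phi>\<in>pverts H \<rightarrow>\<^sub>E U. \<Prod>(u, v)\<in>parcs H. biased_kernel ((1 + t) / 2) (\<phi> u) (\<phi> v))\<bar>
      \<le> real m * (\<eta> * real n ^ 2 * real (card U) ^ (h - 2))"
    unfolding num_embeddings_eq_sum[OF H tournament_oriented, of U n \<omega>, unfolded pverts_oriented, OF U]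
      m_def h_def
  proof (rule counting_lemma[OF finU])
    show "\<bar>\<Sum>x\<in>A. \<Sum>y\<in>B. adjacency (oriented n \<omega>) x y - biased_kernel ((1 + t) / 2) x y\<bar> \<le> \<eta> * (real n)\<^sup>2"
      if "A \<subseteq> U" "B \<subseteq> U" for A B
      using cut that U by blast
  qed (use t in \<open>auto simp: adjacency_def biased_kernel_def field_simps\<close>)
  moreover have "(\<Sum>\<phi>\<in>pverts H \<rightarrow>\<^sub>E U. \<Prod>(u, v)\<in>parcs H. biased_kernel ((1 + t) / 2) (\<phi> u) (\<phi> v))
      = main / 2 ^ m"
    unfolding sum_maps_biased_kernel[OF H finU] t(3) main_def m_def h_def by simp
  moreover have "real m * (\<eta> * real n ^ 2 * real (card U) ^ (h - 2)) \<le> real m * \<eta> * real n ^ h"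
  proof -
    have "2 + (h - 2) = h" using h by (simp add: h_def)
    then have "real n ^ h = real n ^ 2 * real n ^ (h - 2)" by (metis power_add)
    moreover have "real (card U) ^ (h - 2) \<le> real n ^ (h - 2)"
      using cardU by (intro power_mono) auto
    ultimately show ?thesis
      using \<eta> by (simp add: mult.assoc mult_left_mono)
  qed
  moreover have "\<bar>main / 2 ^ m - real (card U) ^ h / 2 ^ m\<bar> \<le> real h ^ 2 * real n ^ (h - 1)"
  proof -
    have "main \<le> real (card U) ^ h"
      using binomial_fact_pow[of "card U" h] unfolding main_def
      by (metis mult.commute of_nat_fact of_nat_le_iff of_nat_mult of_nat_power)
    then have d: "0 \<le> real (card U) ^ h - main" by simp
    have "main / 2 ^ m - real (card U) ^ h / 2 ^ m = - ((real (card U) ^ h - main) / 2 ^ m)"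
      by (simp add: diff_divide_distrib)
    then have "\<bar>main / 2 ^ m - real (card U) ^ h / 2 ^ m\<bar> = (real (card U) ^ h - main) / 2 ^ m"
      using d by simp
    also have "\<dots> \<le> (real (card U) ^ h - main) / 1"
      by (rule divide_left_mono) (use d in simp_all)
    also have "\<dots> \<le> real h ^ 2 * real n ^ (h - 1)"
      using power_minus_falling_factorial[OF cardU, of h] by (simp add: main_def)
    finally show ?thesis .
  qed
  ultimately show ?thesis
    unfolding m[symmetric] h_def[symmetric] m_def[symmetric] by linarith
qed

lemma not_locally_forcingI:
  assumes "\<epsilon> > 0"
    and "\<And>\<delta> n\<^sub>0. \<delta> > 0 \<Longrightarrow> \<exists>(T :: nat pair_pre_digraph) \<sigma>. tournament T \<and> card (pverts T) \<ge> n\<^sub>0 \<and>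
      (\<forall>U \<subseteq> pverts T. \<bar>real (num_embeddings T H U)
          - real (card U) ^ card (pverts H) / 2 ^ (card (pverts H) choose 2)\<bar>
        \<le> \<delta> * real (card (pverts T)) ^ card (pverts H)) \<and> ordering T \<sigma> \<and>
      \<not> \<bar>real (card (forward_arcs \<sigma> T)) - 1 / 2 * real (card (pverts T) choose 2)\<bar>
        \<le> \<epsilon> * real (card (pverts T)) ^ 2"
  shows "\<not> locally_forcing H"
proof
  assume "locally_forcing H"
  from this[unfolded locally_forcing_def Let_def, THEN spec, THEN mp, OF assms(1)]
  obtain \<delta> n\<^sub>0 where "\<delta> > 0" and forced: "\<forall>(T :: nat pair_pre_digraph) n.
      tournament T \<and> card (pverts T) = n \<and> n \<ge> n\<^sub>0 \<and>
      (\<forall>U \<subseteq> pverts T. \<bar>real (num_embeddings T H U)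
          - real (card U) ^ card (pverts H) / 2 ^ (card (pverts H) choose 2)\<bar>
        \<le> \<delta> * real n ^ card (pverts H)) \<longrightarrow>
      (\<forall>\<sigma>. ordering T \<sigma> \<longrightarrow>
        \<bar>real (card (forward_arcs \<sigma> T)) - 1 / 2 * real (n choose 2)\<bar> \<le> \<epsilon> * real n ^ 2)"
    by blast
  from assms(2)[OF \<open>\<delta> > 0\<close>, of n\<^sub>0] obtain T :: "nat pair_pre_digraph" and \<sigma> where
    T: "tournament T" "card (pverts T) \<ge> n\<^sub>0"
      "\<forall>U \<subseteq> pverts T. \<bar>real (num_embeddings T H U)
          - real (card U) ^ card (pverts H) / 2 ^ (card (pverts H) choose 2)\<bar>
        \<le> \<delta> * real (card (pverts T)) ^ card (pverts H)" "ordering T \<sigma>"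
      "\<not> \<bar>real (card (forward_arcs \<sigma> T)) - 1 / 2 * real (card (pverts T) choose 2)\<bar>
        \<le> \<epsilon> * real (card (pverts T)) ^ 2"
    by blast
  show False
    using spec[OF spec[OF forced, of T], of "card (pverts T)"] T by blast
qed

text \<open>
  With \<open>t\<close> a root of \<open>order_poly H t = h!\<close>, the natural ordering of the host exceeds half of the pairs
  by about \<open>t * n\<^sup>2 / 4\<close>, far more than \<open>t * n\<^sup>2 / 32\<close> even after the concentration error.
\<close>
theorem not_locally_forcing:
  assumes H: "tournament H" "2 \<le> card (pverts H)"
    and excess: "score_excess H > 0" and nontrans: "\<nexists>\<sigma>. transitive_order H \<sigma>"
  shows "\<not> locally_forcing H"
proof -
  define h where "h = card (pverts H)"
  define m where "m = card (parcs H)"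
  obtain t where t: "0 < t" "t \<le> 1" "order_poly H t = fact (card (pverts H))"
    using exists_balanced_bias[OF H(1) excess nontrans] by auto
  have host: "\<exists>n \<omega>. n \<ge> n\<^sub>0 \<and>
      (\<forall>U \<subseteq> {1..n}. \<bar>real (num_embeddings (oriented n \<omega>) H U) - real (card U) ^ h / 2 ^ (h choose 2)\<bar>
        \<le> \<delta> * real n ^ h) \<and>
      \<not> \<bar>real (card (forward_arcs id (oriented n \<omega>))) - 1 / 2 * real (n choose 2)\<bar> \<le> t / 32 * real n ^ 2"
    if \<delta>: "\<delta> > 0" for \<delta> :: real and n\<^sub>0
  proof -
    \<comment> \<open>The first bound protects the bias, the second makes \<open>m\<close> arc replacements cost at most \<open>\<delta> / 2\<close>.\<close>
    define \<eta> where "\<eta> = min (t / 32) (\<delta> / (2 * (real m + 1)))"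
    have \<eta>: "\<eta> > 0" "\<eta> \<le> t / 32" "\<eta> \<le> \<delta> / (2 * (real m + 1))"
      using t(1) \<delta> unfolding \<eta>_def by simp (rule min.cobounded1, rule min.cobounded2)
    have large: "eventually (\<lambda>n::nat. real h ^ 2 \<le> \<delta> / 2 * real n) at_top"
      using \<delta> by real_asymp
    have p: "0 \<le> (1 + t) / 2" "(1 + t) / 2 \<le> 1" using t by auto
    define good where "good n \<omega> \<longleftrightarrow> (\<forall>A B. A \<subseteq> {1..n} \<longrightarrow> B \<subseteq> {1..n} \<longrightarrow>
        \<bar>\<Sum>x\<in>A. \<Sum>y\<in>B. adjacency (oriented n \<omega>) x y - biased_kernel ((1 + t) / 2) x y\<bar>
          \<le> \<eta> * real n ^ 2) \<and>
      \<bar>real (card (forward_arcs id (oriented n \<omega>))) - (1 + t) / 2 * real (n choose 2)\<bar>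
        \<le> \<eta> * real n ^ 2" for n \<omega>
    have "eventually (\<lambda>n. \<exists>\<omega>. good n \<omega>) at_top"
      unfolding good_def by (rule eventually_biased_host[OF p \<eta>(1)])
    from eventually_happens'[OF sequentially_bot eventually_conj[OF
        eventually_conj[OF eventually_ge_at_top[of "max 2 n\<^sub>0"] large] this]]
    obtain n \<omega> where n: "n \<ge> 2" "n \<ge> n\<^sub>0" "real h ^ 2 \<le> \<delta> / 2 * real n" and good: "good n \<omega>"
      by auto
    have cut: "\<bar>\<Sum>x\<in>A. \<Sum>y\<in>B. adjacency (oriented n \<omega>) x y - biased_kernel ((1 + t) / 2) x y\<bar>
        \<le> \<eta> * real n ^ 2" if "A \<subseteq> {1..n}" "B \<subseteq> {1..n}" for A B
      using good that unfolding good_def by blast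
    have forward: "\<bar>real (card (forward_arcs id (oriented n \<omega>))) - (1 + t) / 2 * real (n choose 2)\<bar>
        \<le> \<eta> * real n ^ 2"
      using good unfolding good_def by blast
    have counts: "\<bar>real (num_embeddings (oriented n \<omega>) H U) - real (card U) ^ h / 2 ^ (h choose 2)\<bar>
        \<le> \<delta> * real n ^ h" if U: "U \<subseteq> {1..n}" for U
    proof -
      have "\<bar>real (num_embeddings (oriented n \<omega>) H U) - real (card U) ^ h / 2 ^ (h choose 2)\<bar>
          \<le> real m * \<eta> * real n ^ h + real h ^ 2 * real n ^ (h - 1)"
        unfolding h_def m_def
        by (rule biased_host_counts[OF H _ t(2,3) _ cut U]) (use t(1) \<eta>(1) in auto)
      also have "\<dots> \<le> \<delta> / 2 * real n ^ h + \<delta> / 2 * real n ^ h"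
      proof (rule add_mono)
        have "real m * \<eta> \<le> (real m + 1) * (\<delta> / (2 * (real m + 1)))"
          by (rule mult_mono[OF _ \<eta>(3)]) (use \<eta>(1) in auto)
        also have "\<dots> = \<delta> / 2" by (simp add: field_simps)
        finally show "real m * \<eta> * real n ^ h \<le> \<delta> / 2 * real n ^ h"
          by (rule mult_right_mono) simp
        have "real n ^ h = real n * real n ^ (h - 1)"
          using H(2) by (cases h) (auto simp: h_def)
        then show "real h ^ 2 * real n ^ (h - 1) \<le> \<delta> / 2 * real n ^ h"
          using mult_right_mono[OF n(3), of "real n ^ (h - 1)"] by (simp add: mult.assoc)
      qed
      finally show ?thesis by simp
    qed
    have "\<not> \<bar>real (card (forward_arcs id (oriented n \<omega>))) - 1 / 2 * real (n choose 2)\<bar>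
        \<le> t / 32 * real n ^ 2"
    proof
      define N where "N = real (n choose 2)"
      assume "\<bar>real (card (forward_arcs id (oriented n \<omega>))) - 1 / 2 * real (n choose 2)\<bar>
        \<le> t / 32 * real n ^ 2"
      moreover have "\<eta> * real n ^ 2 \<le> t / 32 * real n ^ 2"
        by (rule mult_right_mono[OF \<eta>(2)]) simp
      moreover have "(1 + t) / 2 * N - 1 / 2 * N = t / 2 * N"
        by (simp add: add_divide_distrib distrib_right)
      ultimately have "t / 2 * N \<le> t / 32 * real n ^ 2 + t / 32 * real n ^ 2"
        using forward unfolding N_def[symmetric] abs_le_iff by linarith
      then have "t * (8 * N) \<le> t * real n ^ 2" by (simp add: mult_ac)
      then have "8 * N \<le> real n * real n" using t(1) by (simp add: power2_eq_square)
      moreover have "2 * N = real n * (real n - 1)"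
        using tournament.card_arcs[OF tournament_oriented, of n \<omega>]
          tournament.card_arcs_choose[OF tournament_oriented, of n \<omega>]
        by (simp add: N_def)
      ultimately have "4 * (real n * (real n - 1)) \<le> real n * real n" by linarith
      then have "real n * (4 * (real n - 1)) \<le> real n * real n" by (simp only: mult_ac)
      then have "4 * (real n - 1) \<le> real n" using n(1) by simp
      then show False using n(1) by simp
    qed
    with n(2) counts show ?thesis by blast
  qed
  show ?thesis
  proof (rule not_locally_forcingI)
    show "t / 32 > 0" using t(1) by simp
    fix \<delta> :: real and n\<^sub>0 :: nat assume "\<delta> > 0"
    from host[OF this, of n\<^sub>0] obtain n \<omega> where n: "n \<ge> n\<^sub>0"
      "\<forall>U \<subseteq> {1..n}. \<bar>real (num_embeddings (oriented n \<omega>) H U) - real (card U) ^ h / 2 ^ (h choose 2)\<bar>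
        \<le> \<delta> * real n ^ h"
      "\<not> \<bar>real (card (forward_arcs id (oriented n \<omega>))) - 1 / 2 * real (n choose 2)\<bar> \<le> t / 32 * real n ^ 2"
      by blast
    have "ordering (oriented n \<omega>) id" by (simp add: ordering_def)
    moreover have "card {1..n} = n" by simp
    ultimately show "\<exists>(T :: nat pair_pre_digraph) \<sigma>. tournament T \<and> card (pverts T) \<ge> n\<^sub>0 \<and>
      (\<forall>U \<subseteq> pverts T. \<bar>real (num_embeddings T H U)
          - real (card U) ^ card (pverts H) / 2 ^ (card (pverts H) choose 2)\<bar>
        \<le> \<delta> * real (card (pverts T)) ^ card (pverts H)) \<and> ordering T \<sigma> \<and>
      \<not> \<bar>real (card (forward_arcs \<sigma> T)) - 1 / 2 * real (card (pverts T) choose 2)\<bar>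
        \<le> t / 32 * real (card (pverts T)) ^ 2"
      using n unfolding h_def
      by (intro exI[of _ "oriented n \<omega>"] exI[of _ id] conjI tournament_oriented)
         (simp_all only: pverts_oriented not_False_eq_True)
  qed
qed


section \<open>Random tournaments\<close>

lemma oriented_restrict: "oriented h (\<lambda>e. e \<in> {e \<in> vertex_pairs h. \<omega> e}) = oriented h \<omega>"
  unfolding oriented_def by auto

text \<open>Fair coins make the set of pairs oriented forwards uniform among all subsets of the pairs.\<close>
lemma prob_random_tournament:
  "measure_pmf.prob (random_tournament h) {H. Q H}
    = real (card {Y \<in> Pow (vertex_pairs h). Q (tournament_of h Y)}) / 2 ^ card (vertex_pairs h)"
proof -
  have "random_tournament h = map_pmf (tournament_of h) (map_pmf (\<lambda>\<omega>. {e \<in> vertex_pairs h. \<omega> e})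
      (Pi_pmf (vertex_pairs h) False (\<lambda>_. bernoulli_pmf (1 / 2))))"
    unfolding random_tournament_def pmf.map_comp by (simp only: comp_def oriented_restrict)
  also have "\<dots> = map_pmf (tournament_of h) (pmf_of_set (Pow (vertex_pairs h)))"
    by (subst pmf_of_set_Pow_conv_bernoulli) simp_all
  finally have rt: "random_tournament h = map_pmf (tournament_of h) (pmf_of_set (Pow (vertex_pairs h)))" .
  have "Pow (vertex_pairs h) \<inter> tournament_of h -` {H. Q H}
      = {Y \<in> Pow (vertex_pairs h). Q (tournament_of h Y)}" by auto
  then show ?thesis
    unfolding rt measure_map_pmf by (subst measure_pmf_of_set) (auto simp: card_Pow)
qed

theorem corollary1p4:
  shows "\<exists>(c::real) (h\<^sub>0::nat). c > 0 \<and>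
    (\<forall>h \<ge> h\<^sub>0. measure_pmf.prob (random_tournament h) {H. \<not> locally_forcing H} \<ge> c)"
proof -
  obtain h\<^sub>0 where h\<^sub>0: "\<And>h. h \<ge> h\<^sub>0 \<Longrightarrow> 2 ^ card (vertex_pairs h) / 5184
      \<le> real (card {Y \<in> Pow (vertex_pairs h). score_excess (tournament_of h Y) > 0
          \<and> (\<nexists>\<sigma>. transitive_order (tournament_of h Y) \<sigma>)})"
    using many_nontransitive_with_score_excess unfolding eventually_at_top_linorder by blast
  show ?thesis
  proof (intro exI[of _ "1 / 5184"] exI[of _ "max 2 h\<^sub>0"] conjI allI impI)
    fix h assume h: "h \<ge> max 2 h\<^sub>0"
    have "1 / 5184 \<le> real (card {Y \<in> Pow (vertex_pairs h). score_excess (tournament_of h Y) > 0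
          \<and> (\<nexists>\<sigma>. transitive_order (tournament_of h Y) \<sigma>)}) / 2 ^ card (vertex_pairs h)"
      using h\<^sub>0[of h] h by (simp add: field_simps)
    also have "\<dots> \<le> real (card {Y \<in> Pow (vertex_pairs h). \<not> locally_forcing (tournament_of h Y)})
        / 2 ^ card (vertex_pairs h)"
    proof -
      have "\<not> locally_forcing (tournament_of h Y)"
        if "score_excess (tournament_of h Y) > 0" "\<nexists>\<sigma>. transitive_order (tournament_of h Y) \<sigma>" for Y
        by (rule not_locally_forcing[OF tournament_oriented _ that]) (use h in simp)
      then show ?thesis
        by (intro divide_right_mono of_nat_mono card_mono) auto
    qed
    also have "\<dots> = measure_pmf.prob (random_tournament h) {H. \<not> locally_forcing H}"
      by (rule prob_random_tournament[symmetric])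
    finally show "1 / 5184 \<le> measure_pmf.prob (random_tournament h) {H. \<not> locally_forcing H}" .
  qed simp
qed

end
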